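(* Let $n\ge 2$, let $\Omega\subset\mathbb R^n$ be a bounded open set containing the origin $0$, and let $\varphi$ be a $C^1$ function defined in a neighborhood of $1$ satisfying $\varphi(1)=1$ and $\varphi'(1)>0$. Assume that $u\in C^0(\overline\Omega\setminus\{0\})$, that $v$ is $C^0$ in some open neighborhood of $\overline\Omega$ and $C^1$ in a neighborhood of $0$, and that $$v>0\ \text{ in }\overline\Omega,\qquad u>v\ \text{ on }\overline\Omega\setminus\{0\},\qquad \Delta u\le 0\ \text{ in }\Omega\setminus\{0\}.$$ For $x\in\mathbb R^n$ and $\lambda$ near $1$ set $v^{x,\lambda}_\varphi(y):=\varphi(\lambda)v(x+\lambda y)$. Assume also that there exists some $\epsilon_3>0$ such that for any $|x|<\epsilon_3$ and $|\lambda-1|<\epsilon_3$, $$\inf_{\Omega\setminus\{0\}}\left[u-v^{x,\lambda}_\varphi\right]=0\quad\text{implies}\quad\liminf_{|y|\to 0}\left[u-v^{x,\lambda}_\varphi\right](y)=0 .$$ Then $$\liminf_{|x|\to 0}[u(x)-v(x)]>0 .$$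
   Context: Since $u$ is only assumed continuous, $\Delta u\le 0$ is understood in the distribution sense. *)

theory Defs
  imports "HOL-Analysis.Analysis"
begin

definition partial :: "'a::euclidean_space \<Rightarrow> ('a \<Rightarrow> real) \<Rightarrow> 'a \<Rightarrow> real"
  where "partial b f x = frechet_derivative f (at x) b"

(* Class C^k on S; only meant for open S. The derivatives are taken along the standard basis,
   so every partial derivative up to order k exists and is continuous on S. *)
primrec C_k_on :: "nat \<Rightarrow> 'a::euclidean_space set \<Rightarrow> ('a \<Rightarrow> real) \<Rightarrow> bool"
  where
    "C_k_on 0 S f \<longleftrightarrow> continuous_on S f"
  | "C_k_on (Suc k) S f \<longleftrightarrow>
       (\<forall>x\<in>S. f differentiable (at x)) \<and> (\<forall>b\<in>Basis. C_k_on k S (partial b f))"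

definition laplacian :: "('a::euclidean_space \<Rightarrow> real) \<Rightarrow> 'a \<Rightarrow> real"
  where "laplacian f x = (\<Sum>b\<in>Basis. partial b (partial b f) x)"

(* The space of C^infinity functions with compact support in the open set U,
   extended by zero to the whole space. *)
definition test_functions :: "'a::euclidean_space set \<Rightarrow> ('a \<Rightarrow> real) set"
  where "test_functions U =
    {\<psi>. (\<forall>k. C_k_on k UNIV \<psi>) \<and> compact (closure {x. \<psi> x \<noteq> 0}) \<and> closure {x. \<psi> x \<noteq> 0} \<subseteq> U}"

(* Laplacian of u at most 0 on the open set U in the sense of distributions;
   meant for u that is locally integrable (here: continuous) on U. *)
definition distr_laplacian_nonpos :: "('a::euclidean_space \<Rightarrow> real) \<Rightarrow> 'a set \<Rightarrow> bool"
  where "distr_laplacian_nonpos u U \<longleftrightarrow>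
    (\<forall>\<psi>\<in>test_functions U. (\<forall>x. 0 \<le> \<psi> x) \<longrightarrow> (LINT x:U|lborel. u x * laplacian \<psi> x) \<le> 0)"

definition v_phi :: "(real \<Rightarrow> real) \<Rightarrow> ('a::real_vector \<Rightarrow> real) \<Rightarrow> 'a \<Rightarrow> real \<Rightarrow> 'a \<Rightarrow> real"
  where "v_phi \<phi> v x lam y = \<phi> lam * v (x + lam *\<^sub>R y)"

(* The functions u, v and phi of the theorem are total; their values outside the stated domains
   (closure of Omega without 0, N and I) are arbitrary. This is harmless for the hypothesis on eps3:
   it is preserved when eps3 shrinks, and for small eps3 all arguments lie in the domains, since
   the closure of Omega is compact and N and I are open. Infimum and lim inf are taken in ereal, so
   that no boundedness has to be presupposed; lim inf along the filter at 0 excludes the point 0. *)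

end

theory Submission
  imports Defs
begin

text \<open>
  Suppose the conclusion fails. Then \<open>u - v\<close> comes arbitrarily close to \<open>0\<close> near the origin, so the
  superharmonic function \<open>u\<close>, extended across the origin by its lower limit, takes the value \<open>v 0\<close>
  there, while \<open>u > v\<close> elsewhere: \<open>v\<close> touches \<open>u\<close> from below at the origin. The hypothesis on the
  family \<open>\<phi> \<lambda> v(x + \<lambda> y)\<close> turns this into a contradiction, in three steps.

  \<^item> For every small \<open>x\<close> there is a \<open>\<lambda>\<close> near \<open>1\<close> for which the infimum of \<open>u - v_phi \<phi> v x \<lambda>\<close> is \<open>0\<close>
    (\<open>exists_touching_parameter\<close>): because \<open>\<phi>\<close> increases through \<open>1\<close>, the infimum is nonnegative for
    \<open>\<lambda>\<close> slightly below \<open>1\<close> and negative for \<open>\<lambda>\<close> slightly above. By hypothesis the infimum is then also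
    the lower limit at the origin. Hence \<open>\<phi> \<lambda> v x = v 0\<close>, and every such member of the family
    touches \<open>u\<close> from below at the origin, exactly as \<open>v\<close> does.

  \<^item> Two differentiable functions that touch a superharmonic function from below at the same point
    have the same gradient there (\<open>touching_gradients_eq\<close>): with gradients \<open>a \<plusminus> b\<close> the superharmonic
    function would dominate \<open>v 0 + a \<bullet> y + \<bar>b \<bullet> y\<bar>\<close> up to a small error, and the mean of that function
    over small spheres exceeds \<open>v 0\<close>. Consequently \<open>\<phi> \<lambda> \<lambda> \<nabla>v(x) = \<nabla>v(0)\<close>.

  \<^item> The two relations say that \<open>\<nabla>v(x)\<close> is a positive multiple of the fixed vector \<open>\<nabla>v(0)\<close> whose
    factor \<open>1 / (\<phi> \<lambda> \<lambda>)\<close> is at least \<open>1\<close> where \<open>v x \<ge> v 0\<close> and at most \<open>1\<close> where \<open>v x \<le> v 0\<close>.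
    Integrating along rays, \<open>v y \<ge> v 0 + \<nabla>v(0) \<bullet> y\<close> near the origin (\<open>linear_minorant_along_rays\<close>).
    So \<open>u\<close> lies above an affine function, by a positive margin on a small sphere. The maximum
    principle carries the margin across the puncture to the origin, where there is none.

  The potential theory behind the last two steps is one comparison principle for continuous functions
  that are superharmonic in the sense of distributions (\<open>comparison_principle\<close>). It is proved by
  mollification: the second derivative test is applied, in the form of second difference quotients,
  at an interior minimum of the mollified difference. The origin is removable for functions bounded below
  (\<open>comparison_across_puncture\<close>) since in dimension at least two \<open>- ln \<bar>y\<bar>\<close> is superharmonic and
  tends to infinity at the origin.
\<close>

section \<open>Closure properties of smooth functions\<close>

lemma partial_eq:
  assumes "(f has_derivative f') (at x)"
  shows "partial b f x = f' b"
  using assms unfolding partial_def by (simp add: frechet_derivative_at[symmetric])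

lemma C_k_on_const: "C_k_on k UNIV (\<lambda>x::'a::euclidean_space. c)"
proof (induction k arbitrary: c)
  case (Suc k)
  have "partial b (\<lambda>x::'a. c) = (\<lambda>x. 0)" for b
    by (rule ext, rule partial_eq) (rule has_derivative_const)
  with Suc show ?case by simp
qed simp

lemma C_k_on_inner: "C_k_on k UNIV (\<lambda>x::'a::euclidean_space. (x - z) \<bullet> a)"
proof (cases k)
  case (Suc m)
  have "partial b (\<lambda>x. (x - z) \<bullet> a) = (\<lambda>x. b \<bullet> a)" for b
    by (rule ext, rule partial_eq) (auto intro!: derivative_eq_intros)
  with Suc show ?thesis by (simp add: C_k_on_const)
qed (auto intro!: continuous_intros)

lemma C_k_on_Suc_imp:
  assumes "C_k_on (Suc k) UNIV f"
  shows "C_k_on k UNIV f"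
  using assms
proof (induction k arbitrary: f)
  case 0
  then show ?case by (auto intro!: continuous_at_imp_continuous_on differentiable_imp_continuous_within)
next
  case (Suc k)
  from Suc.prems show ?case
    using Suc.IH by (metis C_k_on.simps(2))
qed

lemma C_k_on_add:
  assumes "C_k_on k UNIV f" "C_k_on k UNIV g"
  shows "C_k_on k UNIV (\<lambda>x. f x + g x)"
  using assms
proof (induction k arbitrary: f g)
  case 0
  then show ?case by (auto intro!: continuous_intros)
next
  case (Suc k)
  have fg: "f differentiable at x" "g differentiable at x" for x
    using Suc.prems by auto
  have "partial b (\<lambda>x. f x + g x) = (\<lambda>x. partial b f x + partial b g x)" for b
    by (intro ext, subst partial_eq[OF has_derivative_add[OF fg[unfolded frechet_derivative_works]]])
      (simp add: partial_def)
  with Suc fg show ?case by (simp add: differentiable_add)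
qed

lemma C_k_on_mult:
  assumes "C_k_on k UNIV f" "C_k_on k UNIV g"
  shows "C_k_on k UNIV (\<lambda>x. f x * g x)"
  using assms
proof (induction k arbitrary: f g)
  case 0
  then show ?case by (auto intro!: continuous_intros)
next
  case (Suc k)
  have fg: "f differentiable at x" "g differentiable at x" for x
    using Suc.prems by auto
  have "partial b (\<lambda>x. f x * g x) = (\<lambda>x. f x * partial b g x + partial b f x * g x)" for b
    by (intro ext, subst partial_eq[OF has_derivative_mult[OF fg[unfolded frechet_derivative_works]]])
      (simp add: partial_def)
  moreover have "C_k_on k UNIV f" "C_k_on k UNIV g"
    using Suc.prems C_k_on_Suc_imp by blast+
  moreover have "C_k_on k UNIV (partial b f)" "C_k_on k UNIV (partial b g)" if "b \<in> Basis" for b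
    using Suc.prems that by auto
  ultimately show ?case
    using fg by (auto intro!: C_k_on_add Suc.IH differentiable_mult)
qed

lemma C_k_on_sum:
  assumes "finite A" "\<And>i. i \<in> A \<Longrightarrow> C_k_on k UNIV (f i)"
  shows "C_k_on k UNIV (\<lambda>x. \<Sum>i\<in>A. f i x)"
  using assms by (induction A rule: finite_induct) (auto simp: C_k_on_const C_k_on_add)

section \<open>A smooth bump function\<close>

text \<open>
  The functions \<open>exp (- 1 / t) / t ^ j\<close>, extended by zero to \<open>t \<le> 0\<close>. The derivative of one of them is a
  linear combination of the next two, so the whole family is smooth, without any formula for the
  higher derivatives of \<open>exp (- 1 / t)\<close>.
\<close>
definition flat_exp :: "nat \<Rightarrow> real \<Rightarrow> real"
  where "flat_exp j t = (if t > 0 then exp (- 1 / t) / t ^ j else 0)"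

lemma flat_exp_tendsto_0: "(flat_exp j \<longlongrightarrow> 0) (at_right 0)"
proof -
  have "((\<lambda>s. s ^ j / exp s) \<longlongrightarrow> (0::real)) at_top"
    by (rule tendsto_power_div_exp_0)
  then have "((\<lambda>t. inverse t ^ j / exp (inverse t)) \<longlongrightarrow> (0::real)) (at_right 0)"
    by (rule filterlim_compose) (rule filterlim_inverse_at_top_right)
  then show ?thesis
  proof (rule Lim_transform_eventually)
    show "\<forall>\<^sub>F t in at_right 0. inverse t ^ j / exp (inverse t) = flat_exp j t"
      unfolding eventually_at_right_field
      by (intro exI[of _ 1]) (auto simp: flat_exp_def exp_minus field_simps)
  qed
qed

lemma flat_exp_deriv:
  "(flat_exp j has_real_derivative flat_exp (j + 2) t - real j * flat_exp (j + 1) t) (at t)"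
proof -
  consider "t > 0" | "t < 0" | "t = 0" by linarith
  then show ?thesis
  proof cases
    case 1
    have "((\<lambda>t. exp (- 1 / t) / t ^ j) has_real_derivative
        flat_exp (j + 2) t - real j * flat_exp (j + 1) t) (at t)"
      using 1 by (auto intro!: derivative_eq_intros simp: flat_exp_def field_simps power2_eq_square)
        (cases j; simp add: field_simps)
    then show ?thesis
      by (rule has_field_derivative_transform_within_open[where S = "{0<..}"])
        (use 1 in \<open>auto simp: flat_exp_def\<close>)
  next
    case 2
    have "((\<lambda>t. 0) has_real_derivative 0) (at t)" by simp
    then have "(flat_exp j has_real_derivative 0) (at t)"
      by (rule has_field_derivative_transform_within_open[where S = "{..<0}"])
        (use 2 in \<open>auto simp: flat_exp_def\<close>)
    with 2 show ?thesis by (simp add: flat_exp_def)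
  next
    case 3
    have R: "((\<lambda>h. flat_exp j h / h) \<longlongrightarrow> 0) (at_right 0)"
    proof (rule Lim_transform_eventually[OF flat_exp_tendsto_0[of "Suc j"]])
      show "\<forall>\<^sub>F x in at_right 0. flat_exp (Suc j) x = flat_exp j x / x"
        unfolding eventually_at_right_field
        by (intro exI[of _ 1]) (auto simp: flat_exp_def)
    qed
    have L: "((\<lambda>h. flat_exp j h / h) \<longlongrightarrow> 0) (at_left 0)"
    proof (rule Lim_transform_eventually[OF tendsto_const])
      show "\<forall>\<^sub>F x in at_left 0. 0 = flat_exp j x / x"
        unfolding eventually_at_left_field
        by (intro exI[of _ "-1"]) (auto simp: flat_exp_def)
    qed
    have "((\<lambda>h. flat_exp j h / h) \<longlongrightarrow> 0) (at 0)"
      by (rule filterlim_split_at[OF L R])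
    with 3 show ?thesis
      by (simp add: DERIV_def flat_exp_def)
  qed
qed

text \<open>
  Each partial derivative is a product of a smooth function
  and a linear combination of members of the same family with larger \<open>j\<close>.
\<close>
lemma C_k_on_flat_exp:
  assumes "\<And>k. C_k_on k UNIV P"
  shows "C_k_on k UNIV (\<lambda>y. flat_exp j (P y))"
proof (induction k arbitrary: j)
  have dP: "P differentiable at x" for x using assms[of "Suc 0"] by simp
  have D: "((\<lambda>y. flat_exp j (P y)) has_derivative
     (\<lambda>h. frechet_derivative P (at x) h * (flat_exp (j + 2) (P x) - real j * flat_exp (j + 1) (P x)))) (at x)" for j x
    using DERIV_compose_FDERIV[OF flat_exp_deriv] dP frechet_derivative_works by blast
  {
    case 0
    have "continuous (at x) (\<lambda>y. flat_exp j (P y))" for x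
      using has_derivative_continuous[OF D] .
    then show ?case by (simp add: continuous_at_imp_continuous_on)
  next
    case (Suc k)
    have "partial b (\<lambda>y. flat_exp j (P y)) =
        (\<lambda>x. partial b P x * (flat_exp (j + 2) (P x) + - real j * flat_exp (j + 1) (P x)))" for b
      by (rule ext, subst partial_eq[OF D]) (simp add: partial_def)
    moreover have "C_k_on k UNIV (\<lambda>x. partial b P x *
        (flat_exp (j + 2) (P x) + - real j * flat_exp (j + 1) (P x)))" if "b \<in> Basis" for b
    proof (intro C_k_on_mult C_k_on_add C_k_on_const Suc.IH)
      show "C_k_on k UNIV (partial b P)"
        using assms[of "Suc k"] that by simp
    qed
    ultimately show ?case
      using differentiableI[OF D] by simp
  }
qed

definition bump :: "real \<Rightarrow> 'a::euclidean_space \<Rightarrow> 'a \<Rightarrow> real"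
  where "bump \<rho> x y = flat_exp 0 (\<rho>\<^sup>2 - (norm (y - x))\<^sup>2)"

lemma C_k_on_bump: "C_k_on k UNIV (bump \<rho> x)"
proof -
  have eq: "\<rho>\<^sup>2 - (norm (y - x))\<^sup>2 = \<rho>\<^sup>2 + (\<Sum>b\<in>Basis. (- 1) * (((y - x) \<bullet> b) * ((y - x) \<bullet> b)))" for y
    by (simp add: power2_norm_eq_inner euclidean_inner[of "y - x" "y - x"] sum_negf)
  have "C_k_on k UNIV (\<lambda>y. \<rho>\<^sup>2 + (\<Sum>b\<in>Basis. (- 1) * (((y - x) \<bullet> b) * ((y - x) \<bullet> b))))" for k
    by (intro C_k_on_add C_k_on_sum C_k_on_mult C_k_on_const C_k_on_inner) simp
  then show ?thesis
    unfolding bump_def eq by (rule C_k_on_flat_exp)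
qed

lemma bump_nonneg: "0 \<le> bump \<rho> x y"
  and bump_le_1: "bump \<rho> x y \<le> 1"
  by (auto simp: bump_def flat_exp_def)

lemma bump_eq_0: "\<rho> \<ge> 0 \<Longrightarrow> dist x y \<ge> \<rho> \<Longrightarrow> bump \<rho> x y = 0"
  by (auto simp: bump_def flat_exp_def dist_norm norm_minus_commute[of x] not_less intro: power_mono)

lemma bump_shift: "bump \<rho> (x + h) y = bump \<rho> x (y - h)"
  by (simp add: bump_def algebra_simps)

lemma continuous_bump: "continuous_on UNIV (bump \<rho> x)"
  using C_k_on_bump[of 0] by simp

lemma bump_test_function:
  assumes "\<rho> > 0" "cball x \<rho> \<subseteq> U"
  shows "bump \<rho> x \<in> test_functions U"
proof -
  have "{y. bump \<rho> x y \<noteq> 0} \<subseteq> cball x \<rho>"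
    using bump_eq_0[of \<rho> x] assms(1) by (auto intro: ccontr)
  then have "closure {y. bump \<rho> x y \<noteq> 0} \<subseteq> cball x \<rho>"
    by (rule closure_minimal) simp
  moreover from this have "compact (closure {y. bump \<rho> x y \<noteq> 0})"
    by (meson bounded_cball bounded_subset closed_closure compact_eq_bounded_closed)
  ultimately show ?thesis
    using assms C_k_on_bump unfolding test_functions_def by blast
qed

section \<open>Second difference quotients\<close>

definition second_diff :: "('a::real_vector \<Rightarrow> real) \<Rightarrow> 'a \<Rightarrow> 'a \<Rightarrow> real \<Rightarrow> real"
  where "second_diff f b x t = (f (x + t *\<^sub>R b) + f (x - t *\<^sub>R b) - 2 * f x) / t\<^sup>2"

text \<open>
  Adding the second order Taylor expansions with Lagrange remainder at \<open>t\<close> and \<open>- t\<close>, in which the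
  first order terms cancel. It serves both to identify limits of second difference quotients and to bound
  them uniformly, as dominated convergence requires.
\<close>
lemma second_diff_mvt:
  fixes f :: "'a::real_vector \<Rightarrow> real" and g' g'' :: "real \<Rightarrow> real"
  assumes "t > 0"
    and g': "\<And>s. \<bar>s\<bar> \<le> t \<Longrightarrow> ((\<lambda>s. f (x + s *\<^sub>R b)) has_real_derivative g' s) (at s)"
    and g'': "\<And>s. \<bar>s\<bar> \<le> t \<Longrightarrow> (g' has_real_derivative g'' s) (at s)"
  obtains r s where "\<bar>r\<bar> \<le> t" "\<bar>s\<bar> \<le> t" "second_diff f b x t = (g'' r + g'' s) / 2"
proof -
  define F where "F m = (if m = 0 then (\<lambda>s. f (x + s *\<^sub>R b)) else if m = 1 then g' else g'')" for m :: nat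
  have F: "\<exists>s. \<bar>s\<bar> \<le> \<bar>c\<bar> \<and> f (x + c *\<^sub>R b) = (\<Sum>m<2. F m 0 / fact m * c ^ m) + F 2 s / fact 2 * c ^ 2"
    if "\<bar>c\<bar> = t" for c
  proof (rule Maclaurin_bi_le)
    show "F 0 = (\<lambda>s. f (x + s *\<^sub>R b))" by (simp add: F_def)
    show "\<forall>m s. m < 2 \<and> \<bar>s\<bar> \<le> \<bar>c\<bar> \<longrightarrow> (F m has_real_derivative F (Suc m) s) (at s)"
      using g' g'' that by (auto simp: F_def)
  qed
  obtain r where r: "\<bar>r\<bar> \<le> t" "f (x + t *\<^sub>R b) = f x + g' 0 * t + g'' r / 2 * t\<^sup>2"
    using F[of t] \<open>t > 0\<close> by (auto simp: F_def numeral_2_eq_2)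
  obtain s where s: "\<bar>s\<bar> \<le> t" "f (x - t *\<^sub>R b) = f x - g' 0 * t + g'' s / 2 * t\<^sup>2"
    using F[of "- t"] \<open>t > 0\<close> by (auto simp: F_def numeral_2_eq_2)
  have "second_diff f b x t = (g'' r + g'' s) / 2"
    using \<open>t > 0\<close> by (simp add: second_diff_def r(2) s(2) field_simps)
  with r(1) s(1) show thesis by (rule that)
qed

lemma second_diff_tendsto:
  fixes f :: "'a::real_vector \<Rightarrow> real"
  assumes "d > 0"
    and g': "\<And>s. \<bar>s\<bar> < d \<Longrightarrow> ((\<lambda>s. f (x + s *\<^sub>R b)) has_real_derivative g' s) (at s)"
    and g'': "\<And>s. \<bar>s\<bar> < d \<Longrightarrow> (g' has_real_derivative g'' s) (at s)"
    and cont: "isCont g'' 0"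
  shows "(second_diff f b x \<longlongrightarrow> g'' 0) (at_right 0)"
proof (rule tendstoI)
  fix e :: real assume "e > 0"
  with cont obtain c where "c > 0" and "\<forall>s. \<bar>s - 0\<bar> < c \<longrightarrow> \<bar>g'' s - g'' 0\<bar> < e"
    unfolding continuous_at_real_range real_norm_def by blast
  then have c: "\<bar>g'' s - g'' 0\<bar> < e" if "\<bar>s\<bar> < c" for s
    using that by simp
  show "\<forall>\<^sub>F t in at_right 0. dist (second_diff f b x t) (g'' 0) < e"
    unfolding eventually_at_right_field
  proof (intro exI[of _ "min c d"] conjI allI impI)
    fix t :: real assume t: "t > 0" "t < min c d"
    obtain r s where rs: "\<bar>r\<bar> \<le> t" "\<bar>s\<bar> \<le> t" "second_diff f b x t = (g'' r + g'' s) / 2"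
    proof (rule second_diff_mvt[OF t(1)])
      fix s assume "\<bar>s\<bar> \<le> t"
      with t(2) show "((\<lambda>s. f (x + s *\<^sub>R b)) has_real_derivative g' s) (at s)"
        "(g' has_real_derivative g'' s) (at s)"
        by (auto intro: g' g'')
    qed
    have "\<bar>g'' r - g'' 0\<bar> < e" "\<bar>g'' s - g'' 0\<bar> < e"
      using rs t(2) by (auto intro: c)
    then show "dist (second_diff f b x t) (g'' 0) < e"
      by (auto simp: dist_real_def rs(3) abs_less_iff field_simps)
  qed (use \<open>c > 0\<close> \<open>d > 0\<close> in auto)
qed

lemma has_real_derivative_along_line:
  fixes f :: "'a::euclidean_space \<Rightarrow> real"
  assumes "f differentiable (at (x + s *\<^sub>R b))"
  shows "((\<lambda>s. f (x + s *\<^sub>R b)) has_real_derivative partial b f (x + s *\<^sub>R b)) (at s)"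
proof -
  let ?f' = "frechet_derivative f (at (x + s *\<^sub>R b))"
  have f': "(f has_derivative ?f') (at (x + s *\<^sub>R b))"
    using assms by (simp add: frechet_derivative_works)
  have "((\<lambda>s. f (x + s *\<^sub>R b)) has_derivative (\<lambda>h. ?f' (h *\<^sub>R b))) (at s)"
    by (rule has_derivative_compose[where f = "\<lambda>s. x + s *\<^sub>R b", OF _ f']) (auto intro!: derivative_eq_intros)
  moreover have "?f' (h *\<^sub>R b) = partial b f (x + s *\<^sub>R b) * h" for h
    using linear_scale[OF has_derivative_linear[OF f']] by (simp add: partial_def)
  ultimately show ?thesis
    by (simp add: has_field_derivative_def)
qed

lemma C_2_along_line:
  fixes f :: "'a::euclidean_space \<Rightarrow> real"
  assumes "C_k_on 2 UNIV f" "b \<in> Basis"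
  shows "((\<lambda>s. f (x + s *\<^sub>R b)) has_real_derivative partial b f (x + s *\<^sub>R b)) (at s)"
    and "((\<lambda>s. partial b f (x + s *\<^sub>R b)) has_real_derivative partial b (partial b f) (x + s *\<^sub>R b)) (at s)"
    and "continuous_on UNIV (partial b (partial b f))"
  using assms by (auto simp: numeral_2_eq_2 intro!: has_real_derivative_along_line)

lemma second_diff_C_2_tendsto:
  fixes f :: "'a::euclidean_space \<Rightarrow> real"
  assumes "C_k_on 2 UNIV f" "b \<in> Basis"
  shows "(second_diff f b x \<longlongrightarrow> partial b (partial b f) x) (at_right 0)"
proof -
  have "continuous_on UNIV (\<lambda>s. partial b (partial b f) (x + s *\<^sub>R b))"
    by (rule continuous_on_compose2[OF C_2_along_line(3)[OF assms]]) (auto intro!: continuous_intros)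
  then have "isCont (\<lambda>s. partial b (partial b f) (x + s *\<^sub>R b)) 0"
    by (simp add: continuous_on_eq_continuous_at)
  with second_diff_tendsto[of 1 f x b, OF _ C_2_along_line(1,2)[OF assms]] show ?thesis
    by simp
qed

lemma second_diff_add: "second_diff (\<lambda>x. f x + g x) b x t = second_diff f b x t + second_diff g b x t"
  and second_diff_cmult: "second_diff (\<lambda>x. c * f x) b x t = c * second_diff f b x t"
  by (simp_all add: second_diff_def add_divide_distrib[symmetric] algebra_simps)

lemma second_diff_const: "second_diff (\<lambda>x. c) b x t = 0"
  by (simp add: second_diff_def)

lemma second_diff_inner: "second_diff (\<lambda>x. a \<bullet> x) b x t = 0"
  by (simp add: second_diff_def inner_add_right inner_diff_right)

lemma norm_sq_along_line:
  "b \<in> Basis \<Longrightarrow> (norm (x + s *\<^sub>R b))\<^sup>2 = (norm x)\<^sup>2 + 2 * s * (x \<bullet> b) + s\<^sup>2"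
  by (simp only: power2_norm_eq_inner)
    (simp add: inner_add_left inner_add_right inner_commute[of b x] power2_eq_square algebra_simps)

lemma second_diff_norm_sq: 
  "t \<noteq> 0 \<Longrightarrow> b \<in> Basis \<Longrightarrow> second_diff (\<lambda>x. (norm x)\<^sup>2) b x t = 2"
  using norm_sq_along_line[of b x t] norm_sq_along_line[of b x "- t"] by (simp add: second_diff_def)

lemma second_diff_inner_sq:
  "t \<noteq> 0 \<Longrightarrow> second_diff (\<lambda>x. (e \<bullet> x)\<^sup>2) b x t = 2 * (e \<bullet> b)\<^sup>2"
  by (simp add: second_diff_def inner_add_right inner_diff_right power2_eq_square field_simps)

lemma second_diff_ln_norm_sq_tendsto:
  fixes x :: "'a::euclidean_space"
  assumes "x \<noteq> 0" "b \<in> Basis"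
  shows "(second_diff (\<lambda>x. ln ((norm x)\<^sup>2)) b x \<longlongrightarrow> 2 / (norm x)\<^sup>2 - 4 * (x \<bullet> b)\<^sup>2 / (norm x) ^ 4) (at_right 0)"
proof -
  let ?n = "\<lambda>s. (norm x)\<^sup>2 + 2 * s * (x \<bullet> b) + s\<^sup>2"
  have n: "(norm (x + s *\<^sub>R b))\<^sup>2 = ?n s" for s
    using assms(2) by (rule norm_sq_along_line)
  have pos: "?n s > 0" if "\<bar>s\<bar> < norm x" for s
  proof -
    have "x + s *\<^sub>R b \<noteq> 0"
      using that assms(2) norm_minus_cancel[of "s *\<^sub>R b"] by (auto simp: eq_neg_iff_add_eq_0[symmetric])
    then show ?thesis unfolding n[symmetric] by simp
  qed
  have "(second_diff (\<lambda>x. ln ((norm x)\<^sup>2)) b x \<longlongrightarrow>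
     (\<lambda>s. 2 / ?n s - (2 * (x \<bullet> b) + 2 * s)\<^sup>2 / (?n s)\<^sup>2) 0) (at_right 0)"
  proof (rule second_diff_tendsto[where d = "norm x" and g' = "\<lambda>s. (2 * (x \<bullet> b) + 2 * s) / ?n s"])
    fix s assume s: "\<bar>s\<bar> < norm x"
    show "((\<lambda>s. ln ((norm (x + s *\<^sub>R b))\<^sup>2)) has_real_derivative (2 * (x \<bullet> b) + 2 * s) / ?n s) (at s)"
      unfolding n using pos[OF s] by (auto intro!: derivative_eq_intros)
    have eq: "(2 * N - w * w) / (N * N) = 2 / N - w\<^sup>2 / N\<^sup>2" if "N > 0" for N w :: real
      using that by (simp add: field_simps power2_eq_square)
    have "((\<lambda>s. (2 * (x \<bullet> b) + 2 * s) / ?n s) has_real_derivative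
        (2 * ?n s - (2 * (x \<bullet> b) + 2 * s) * (2 * (x \<bullet> b) + 2 * s)) / (?n s * ?n s)) (at s)"
      using pos[OF s] by (auto intro!: derivative_eq_intros)
    then show "((\<lambda>s. (2 * (x \<bullet> b) + 2 * s) / ?n s) has_real_derivative
        2 / ?n s - (2 * (x \<bullet> b) + 2 * s)\<^sup>2 / (?n s)\<^sup>2) (at s)"
      unfolding eq[OF pos[OF s]] .
  next
    show "isCont (\<lambda>s. 2 / ?n s - (2 * (x \<bullet> b) + 2 * s)\<^sup>2 / (?n s)\<^sup>2) 0"
      using assms(1) by (intro continuous_intros) auto
  qed (use assms in simp)
  then show ?thesis by (simp add: power_mult_distrib)
qed

section \<open>Integrals and Laplacians of bumps\<close>

lemma partial_eq_0_on_open: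
  assumes "open S" "\<And>y. y \<in> S \<Longrightarrow> f y = 0" "x \<in> S"
  shows "partial b f x = 0"
proof -
  have "(f has_derivative (\<lambda>h. 0)) (at x)"
    by (rule has_derivative_transform_within_open[of "\<lambda>x. 0" _ x UNIV S]) (use assms in auto)
  then show ?thesis by (rule partial_eq)
qed

lemma laplacian_bump_eq_0:
  assumes "\<rho> > 0" "dist x y > \<rho>"
  shows "laplacian (bump \<rho> x) y = 0"
proof -
  let ?S = "- cball x \<rho>"
  have S: "open ?S" by (rule open_Compl) simp
  have "partial b (bump \<rho> x) z = 0" if "z \<in> ?S" for b z
    using bump_eq_0[of \<rho> x] assms(1) by (intro partial_eq_0_on_open[OF S _ that]) auto
  then have "partial b (partial b (bump \<rho> x)) y = 0" for b
    by (rule partial_eq_0_on_open[OF S]) (use assms(2) in auto)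
  then show ?thesis by (simp add: laplacian_def)
qed

lemma integrable_bump: "\<rho> > 0 \<Longrightarrow> integrable lborel (bump \<rho> x)"
proof -
  assume "\<rho> > 0"
  have "integrable lborel (\<lambda>y. indicator (cball x \<rho>) y *\<^sub>R bump \<rho> x y)"
    by (rule borel_integrable_compact) (use continuous_on_subset[OF continuous_bump] in auto)
  also have "(\<lambda>y. indicator (cball x \<rho>) y *\<^sub>R bump \<rho> x y) = bump \<rho> x"
    using bump_eq_0[of \<rho> x] \<open>\<rho> > 0\<close> by (auto simp: fun_eq_iff indicator_def)
  finally show ?thesis .
qed

lemma integral_bump_shift:
  fixes x :: "'a::euclidean_space"
  shows "(\<integral>y. bump \<rho> x y \<partial>lborel) = (\<integral>y. bump \<rho> (0::'a) y \<partial>lborel)"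
proof -
  have "(\<integral>y. bump \<rho> x y \<partial>distr lborel borel ((+) x)) = (\<integral>y. bump \<rho> x (x + y) \<partial>lborel)"
    by (rule integral_distr) (use borel_measurable_continuous_onI[OF continuous_bump] in auto)
  then show ?thesis
    by (simp add: lborel_distr_plus bump_def)
qed

lemma integral_bump_pos: 
  assumes "\<rho> > 0"
  shows "(\<integral>y. bump \<rho> (0::'a::euclidean_space) y \<partial>lborel) > 0"
proof -
  let ?c = "exp (- 1 / (3 * \<rho>\<^sup>2 / 4))"
  have "?c * measure lborel (ball (0::'a) (\<rho> / 2)) = (\<integral>y. ?c * indicator (ball 0 (\<rho> / 2)) y \<partial>(lborel::'a measure))"
    by simp
  also have "\<dots> \<le> (\<integral>y. bump \<rho> (0::'a) y \<partial>lborel)"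
  proof (rule integral_mono)
    show "integrable lborel (\<lambda>y. ?c * indicator (ball (0::'a) (\<rho> / 2)) y)"
      by (intro integrable_mult_right integrable_real_indicator) (use emeasure_lborel_ball_finite[of "0::'a"] in auto)
    show "integrable lborel (bump \<rho> (0::'a))" using assms by (rule integrable_bump)
    fix y :: 'a
    show "?c * indicator (ball 0 (\<rho> / 2)) y \<le> bump \<rho> 0 y"
    proof (cases "y \<in> ball 0 (\<rho> / 2)")
      case True
      then have "(norm y)\<^sup>2 \<le> (\<rho> / 2)\<^sup>2" by (intro power_mono) auto
      then have *: "3 * \<rho>\<^sup>2 / 4 \<le> \<rho>\<^sup>2 - (norm y)\<^sup>2" by (simp add: power_divide)
      moreover have "3 * \<rho>\<^sup>2 / 4 > 0" using assms by simp
      moreover from this * have "\<rho>\<^sup>2 - (norm y)\<^sup>2 > 0" by linarith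
      ultimately show ?thesis
        using True by (auto simp: bump_def flat_exp_def intro!: le_imp_inverse_le divide_left_mono mult_pos_pos simp del: divide_divide_eq_right)
    qed (simp add: bump_nonneg)
  qed
  finally show ?thesis
    using mult_pos_pos[OF exp_gt_zero content_ball_pos[of "\<rho> / 2" "0::'a"], of "- 1 / (3 * \<rho>\<^sup>2 / 4)"] assms
    by linarith
qed

section \<open>Mollification\<close>

lemma compact_closed_neighbourhood:
  fixes K :: "'a::euclidean_space set"
  assumes "compact K"
  shows "compact (\<Union>x\<in>K. cball x d)"
proof -
  have "(\<Union>x\<in>K. cball x d) = {x + z |x z. x \<in> K \<and> z \<in> cball 0 d}"
  proof (intro set_eqI iffI)
    fix y assume "y \<in> (\<Union>x\<in>K. cball x d)"
    then obtain x where "x \<in> K" "y - x \<in> cball 0 d" by (auto simp: dist_norm norm_minus_commute)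
    then show "y \<in> {x + z |x z. x \<in> K \<and> z \<in> cball 0 d}" by force
  qed (force simp: dist_norm)
  with compact_sums[OF assms compact_cball[of 0 d]] show ?thesis by simp
qed

text \<open>
  The bump is not normalised; the constant factor \<open>\<integral> bump\<close> is carried along instead.
\<close>
definition mollify :: "real \<Rightarrow> ('a::euclidean_space \<Rightarrow> real) \<Rightarrow> 'a \<Rightarrow> real"
  where "mollify \<rho> g x = (\<integral>y. g y * bump \<rho> x y \<partial>lborel)"

lemma integrable_mult_bump:
  assumes "integrable lborel g"
  shows "integrable lborel (\<lambda>y. g y * bump \<rho> x y)"
proof (rule Bochner_Integration.integrable_bound[OF assms])
  show "(\<lambda>y. g y * bump \<rho> x y) \<in> borel_measurable lborel"
    using borel_measurable_integrable[OF assms] borel_measurable_continuous_onI[OF continuous_bump[of \<rho> x]]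
    by (auto intro!: borel_measurable_times)
  show "AE y in lborel. norm (g y * bump \<rho> x y) \<le> norm (g y)"
    by (intro AE_I2) (auto simp: abs_mult bump_nonneg bump_le_1 intro!: mult_left_le)
qed

lemma mollify_close:
  assumes "integrable lborel g" "\<rho> > 0" 
    and osc: "\<And>y. dist x y < \<rho> \<Longrightarrow> \<bar>g y - c\<bar> \<le> \<kappa>"
  shows "\<bar>mollify \<rho> g x - c * (\<integral>y. bump \<rho> x y \<partial>lborel)\<bar> \<le> \<kappa> * (\<integral>y. bump \<rho> x y \<partial>lborel)"
proof -
  have i: "integrable lborel (bump \<rho> x)" using assms(2) by (rule integrable_bump)
  have "\<bar>\<integral>y. g y * bump \<rho> x y - c * bump \<rho> x y \<partial>lborel\<bar> \<le> (\<integral>y. \<kappa> * bump \<rho> x y \<partial>lborel)"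
  proof (rule integral_abs_bound_integral)
    fix y
    show "\<bar>g y * bump \<rho> x y - c * bump \<rho> x y\<bar> \<le> \<kappa> * bump \<rho> x y"
    proof (cases "dist x y < \<rho>")
      case True
      have "\<bar>g y * bump \<rho> x y - c * bump \<rho> x y\<bar> = \<bar>g y - c\<bar> * bump \<rho> x y"
        by (simp add: left_diff_distrib[symmetric] abs_mult bump_nonneg)
      then show ?thesis using mult_right_mono[OF osc[OF True] bump_nonneg[of \<rho> x y]] by linarith
    next
      case False
      then show ?thesis using bump_eq_0[of \<rho> x y] assms(2) by simp
    qed
  qed (use i integrable_mult_bump[OF assms(1)] in auto)
  then show ?thesis
    using i integrable_mult_bump[OF assms(1)] by (simp add: mollify_def)
qed

lemma continuous_mollify:
  assumes "integrable lborel g"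
  shows "continuous_on S (mollify \<rho> g)"
  unfolding continuous_on_sequentially
proof (intro allI ballI impI)
  fix X x assume "x \<in> S" and X: "(\<forall>n. X n \<in> S) \<and> X \<longlonglongrightarrow> x"
  have sym: "bump \<rho> x y = bump \<rho> y x" for x y :: 'a
    by (simp add: bump_def norm_minus_commute)
  have "(\<lambda>n. \<integral>y. g y * bump \<rho> (X n) y \<partial>lborel) \<longlonglongrightarrow> (\<integral>y. g y * bump \<rho> x y \<partial>lborel)"
  proof (rule integral_dominated_convergence)
    show "integrable lborel (\<lambda>y. norm (g y))" using assms by simp
    have "(\<lambda>n. g y * bump \<rho> (X n) y) \<longlonglongrightarrow> g y * bump \<rho> x y" for y
    proof -
      have "isCont (bump \<rho> y) x"
        using continuous_bump[of \<rho> y] by (simp add: continuous_on_eq_continuous_at)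
      then show ?thesis
        unfolding sym[of _ y] using X by (intro tendsto_mult_left isCont_tendsto_compose[of x "bump \<rho> y"]) auto
    qed
    then show "AE y in lborel. (\<lambda>n. g y * bump \<rho> (X n) y) \<longlonglongrightarrow> g y * bump \<rho> x y" by simp
    show "AE y in lborel. norm (g y * bump \<rho> (X n) y) \<le> norm (g y)" for n
      by (intro AE_I2) (auto simp: abs_mult bump_nonneg bump_le_1 intro!: mult_left_le)
  qed (use integrable_mult_bump[OF assms] in auto)
  then show "(mollify \<rho> g \<circ> X) \<longlonglongrightarrow> mollify \<rho> g x"
    by (simp add: comp_def mollify_def)
qed

text \<open>
  Shifting the centre of the bump by \<open>h\<close> shifts its argument by \<open>- h\<close>, and a second difference is
  symmetric in \<open>h\<close>; so the difference quotient passes from the mollified function to the bump.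
\<close>
lemma second_diff_mollify:
  assumes "integrable lborel g"
  shows "second_diff (mollify \<rho> g) b x t = (\<integral>y. g y * second_diff (bump \<rho> x) b y t \<partial>lborel)"
proof -
  note i = integrable_mult_bump[OF assms, of \<rho>]
  have "(\<integral>y. g y * second_diff (bump \<rho> x) b y t \<partial>lborel) =
    (\<integral>y. (g y * bump \<rho> (x - t *\<^sub>R b) y + g y * bump \<rho> (x + t *\<^sub>R b) y - 2 * (g y * bump \<rho> x y)) / t\<^sup>2 \<partial>lborel)"
    using bump_shift[of \<rho> x "t *\<^sub>R b"] bump_shift[of \<rho> x "- (t *\<^sub>R b)"]
    by (intro Bochner_Integration.integral_cong) (auto simp: second_diff_def algebra_simps)
  also have "\<dots> = second_diff (mollify \<rho> g) b x t"
    using i by (simp add: second_diff_def mollify_def)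
  finally show ?thesis ..
qed

lemma second_diff_mollify_tendsto:
  assumes g: "integrable lborel g" and \<rho>: "\<rho> > 0" and b: "b \<in> Basis" and c: "c > 0"
  shows "(\<lambda>n. second_diff (mollify \<rho> g) b x (c / real (Suc n))) 
    \<longlonglongrightarrow> (\<integral>y. g y * partial b (partial b (bump \<rho> x)) y \<partial>lborel)"
proof -
  let ?f = "bump \<rho> x" and ?t = "\<lambda>n. c / real (Suc n)"
  note C2 = C_2_along_line[OF C_k_on_bump b, of \<rho> x]
  have t0: "filterlim ?t (at_right 0) sequentially"
  proof -
    have "?t \<longlonglongrightarrow> 0" by (rule LIMSEQ_Suc[OF lim_const_over_n])
    then show ?thesis using c unfolding filterlim_at by auto
  qed
  have tc: "0 < ?t n" "?t n \<le> c" for n using c by (auto simp: field_simps)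
  let ?S = "cball x (\<rho> + 2 * c)"
  obtain B where B: "\<And>y. y \<in> ?S \<Longrightarrow> \<bar>partial b (partial b ?f) y\<bar> \<le> B"
    using compact_imp_bounded[OF compact_continuous_image[OF continuous_on_subset[OF C2(3)] compact_cball[of x "\<rho> + 2 * c"]]]
    unfolding bounded_iff by (metis imageI real_norm_def top_greatest)
  have B0: "B \<ge> 0" using B[of x] \<rho> c by force
  \<comment> \<open>Near the support of the bump the mean value form applies; away from it all three values vanish.\<close>
  have bound: "\<bar>second_diff ?f b y (?t n)\<bar> \<le> B" for y n
  proof (cases "dist x y \<le> \<rho> + c")
    case True
    obtain r s where rs: "\<bar>r\<bar> \<le> ?t n" "\<bar>s\<bar> \<le> ?t n"
      "second_diff ?f b y (?t n) =
        (partial b (partial b ?f) (y + r *\<^sub>R b) + partial b (partial b ?f) (y + s *\<^sub>R b)) / 2"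
      using second_diff_mvt[OF tc(1) C2(1,2)] by blast
    have "y + r *\<^sub>R b \<in> ?S" if "\<bar>r\<bar> \<le> ?t n" for r
    proof -
      have "norm (r *\<^sub>R b) \<le> c" using that tc[of n] b by simp
      then show ?thesis using True norm_triangle_ineq4[of "x - y" "r *\<^sub>R b"] 
        by (simp add: dist_norm algebra_simps)
    qed
    with rs(1,2) B have "\<bar>partial b (partial b ?f) (y + r *\<^sub>R b)\<bar> \<le> B" "\<bar>partial b (partial b ?f) (y + s *\<^sub>R b)\<bar> \<le> B"
      by blast+
    then show ?thesis unfolding rs(3) abs_le_iff by (simp add: field_simps)
  next
    case False
    have "?f (y + h) = 0" if "norm h \<le> c" for h
    proof (rule bump_eq_0)
      have "norm (x - y) \<le> norm (x - (y + h)) + norm h"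
        using norm_triangle_ineq[of "x - (y + h)" h] by simp
      then show "\<rho> \<le> dist x (y + h)" using False that by (simp add: dist_norm)
    qed (use \<rho> in simp)
    from this[of "?t n *\<^sub>R b"] this[of "- (?t n *\<^sub>R b)"] this[of 0] show ?thesis
      using b tc[of n] c B0 by (simp add: second_diff_def)
  qed
  have "continuous_on UNIV (\<lambda>y. second_diff ?f b y t)" for t
    by (cases "t = 0")
      (auto simp: second_diff_def intro!: continuous_intros continuous_on_compose2[OF continuous_bump])
  then have m: "(\<lambda>y. second_diff ?f b y t) \<in> borel_measurable lborel" for t
    using borel_measurable_continuous_onI by auto
  have "(\<lambda>n. \<integral>y. g y * second_diff ?f b y (?t n) \<partial>lborel) \<longlonglongrightarrow>
      (\<integral>y. g y * partial b (partial b ?f) y \<partial>lborel)"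
  proof (rule integral_dominated_convergence)
    show "integrable lborel (\<lambda>y. B * norm (g y))" using g by simp
    show "AE y in lborel. (\<lambda>n. g y * second_diff ?f b y (?t n)) \<longlonglongrightarrow> g y * partial b (partial b ?f) y"
      by (intro AE_I2 tendsto_mult_left filterlim_compose[OF second_diff_C_2_tendsto[OF C_k_on_bump b] t0])
    show "AE y in lborel. norm (g y * second_diff ?f b y (?t n)) \<le> B * norm (g y)" for n
      using mult_right_mono[OF bound abs_ge_zero] by (intro AE_I2) (simp add: abs_mult mult.commute)
    show "(\<lambda>y. g y * partial b (partial b ?f) y) \<in> borel_measurable lborel"
      using borel_measurable_integrable[OF g] borel_measurable_continuous_onI[OF C2(3)]
      by (auto intro!: borel_measurable_times)
    show "(\<lambda>y. g y * second_diff ?f b y (?t n)) \<in> borel_measurable lborel" for n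
      using borel_measurable_integrable[OF g] m by (auto intro!: borel_measurable_times)
  qed
  then show ?thesis by (simp add: second_diff_mollify[OF g])
qed

section \<open>The comparison principle for distributional supersolutions\<close>

text \<open>
  If \<open>u - q\<close> were negative somewhere, its minimum over \<open>K\<close> would lie in the interior, and this survives
  mollification of \<open>u\<close> at a scale on which \<open>u\<close> oscillates by less than a third of the depth of the
  minimum. At a minimum \<open>x0\<close> of the mollified difference the second differences of the mollification of
  \<open>u\<close> dominate those of \<open>q\<close>. In the limit their sum is the integral of \<open>u\<close> against the Laplacian of a
  bump around \<open>x0\<close>, which is at most zero, whereas the sum for \<open>q\<close> is positive.
  Phrasing the hypothesis on \<open>q\<close> through second differences makes it immediate for the quadratic
  functions used below.
\<close>
lemma comparison_principle:
  fixes u q :: "'a::euclidean_space \<Rightarrow> real"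
  assumes U: "open U" "continuous_on U u" "distr_laplacian_nonpos u U"
    and K: "compact K" "K \<subseteq> U" and q: "continuous_on K q"
    and D: "\<And>x b. x \<in> interior K \<Longrightarrow> b \<in> Basis \<Longrightarrow> (second_diff q b x \<longlongrightarrow> D b x) (at_right 0)"
    and pos: "\<And>x. x \<in> interior K \<Longrightarrow> (\<Sum>b\<in>Basis. D b x) > 0"
    and boundary: "\<And>x. x \<in> K - interior K \<Longrightarrow> q x \<le> u x"
    and "x \<in> K"
  shows "q x \<le> u x"
proof (rule ccontr)
  assume "\<not> q x \<le> u x"
  have "continuous_on K (\<lambda>x. u x - q x)"
    by (intro continuous_intros q continuous_on_subset[OF U(2) K(2)])
  then obtain p where p: "p \<in> K" "\<And>y. y \<in> K \<Longrightarrow> u p - q p \<le> u y - q y"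
    using continuous_attains_inf[OF K(1), of "\<lambda>x. u x - q x"] \<open>x \<in> K\<close> by auto
  \<comment> \<open>The error of mollification counts twice, at \<open>p\<close> and at a boundary point, which leaves one third.\<close>
  define \<kappa> where "\<kappa> = (q p - u p) / 3"
  have \<kappa>: "\<kappa> > 0" using p(2)[OF \<open>x \<in> K\<close>] \<open>\<not> q x \<le> u x\<close> by (simp add: \<kappa>_def)
  obtain d where d: "d > 0" "(\<Union>x\<in>K. cball x d) \<subseteq> U"
    using compact_subset_open_imp_cball_epsilon_subset[OF K(1) U(1) K(2)] by blast
  define C where "C = (\<Union>x\<in>K. cball x d)"
  have C: "compact C" "C \<subseteq> U" unfolding C_def by (rule compact_closed_neighbourhood[OF K(1)]) (rule d(2))
  have uC: "continuous_on C u" using U(2) C(2) continuous_on_subset by blast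
  obtain e where e: "e > 0" "\<And>y z. y \<in> C \<Longrightarrow> z \<in> C \<Longrightarrow> dist y z < e \<Longrightarrow> \<bar>u y - u z\<bar> < \<kappa>"
    using compact_uniformly_continuous[OF uC C(1)] \<kappa> unfolding uniformly_continuous_on_def dist_real_def by metis
  define \<rho> where "\<rho> = min d e"
  have \<rho>: "\<rho> > 0" "\<rho> \<le> d" "\<rho> \<le> e" using d e by (auto simp: \<rho>_def)
  \<comment> \<open>Cutting \<open>u\<close> off outside the compact neighbourhood \<open>C\<close> makes it integrable and changes no value that the bumps around points of \<open>K\<close> can see.\<close>
  define g where "g = (\<lambda>y. indicator C y *\<^sub>R u y)"
  have g: "integrable lborel g" unfolding g_def by (rule borel_integrable_compact[OF C(1) uC])
  define M where "M = (\<integral>y. bump \<rho> (0::'a) y \<partial>lborel)"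
  have M: "M > 0" unfolding M_def by (rule integral_bump_pos[OF \<rho>(1)])
  define J where "J = mollify \<rho> g"
  have J: "\<bar>J y - u y * M\<bar> \<le> \<kappa> * M" if "y \<in> K" for y
  proof -
    have "\<bar>g z - u y\<bar> \<le> \<kappa>" if z: "dist y z < \<rho>" for z
    proof -
      have "y \<in> C" "z \<in> C" using \<open>y \<in> K\<close> z \<rho> d(1) by (force simp: C_def)+
      then show ?thesis using e(2)[of z y] z \<rho>(3) by (simp add: g_def dist_commute)
    qed
    then show ?thesis
      using mollify_close[OF g \<rho>(1), of y "u y" \<kappa>] by (simp add: J_def M_def integral_bump_shift[of \<rho> y])
  qed
  have "continuous_on K (\<lambda>y. J y - M * q y)"
    unfolding J_def by (intro continuous_intros q continuous_mollify g)
  then obtain x0 where x0: "x0 \<in> K" "\<And>y. y \<in> K \<Longrightarrow> J x0 - M * q x0 \<le> J y - M * q y"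
    using continuous_attains_inf[OF K(1), of "\<lambda>y. J y - M * q y"] p(1) by auto
  have x0_int: "x0 \<in> interior K"
  proof (rule ccontr)
    assume "x0 \<notin> interior K"
    then have "q x0 * M \<le> u x0 * M" using boundary[of x0] x0(1) M by (simp add: mult_right_mono)
    moreover have "u p * M = q p * M - 3 * \<kappa> * M" by (simp add: \<kappa>_def field_simps)
    moreover have "\<kappa> * M > 0" using \<kappa> M by simp
    ultimately show False
      using J[OF x0(1)] J[OF p(1)] x0(2)[OF p(1)] unfolding mult.commute[of M] abs_le_iff by linarith
  qed
  then obtain c where c: "c > 0" "ball x0 c \<subseteq> K"
    by (meson interior_subset open_contains_ball open_interior subset_trans)
  let ?t = "\<lambda>n. (c / 2) / real (Suc n)"
  have t: "0 < ?t n" "?t n < c" for n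
  proof -
    have "?t n \<le> c / 2" using c(1) by (simp add: field_simps)
    then show "?t n < c" using c(1) by linarith
  qed (use c(1) in simp)
  have t0: "filterlim ?t (at_right 0) sequentially"
    unfolding filterlim_at using t(1) LIMSEQ_Suc[OF lim_const_over_n[of "c / 2"]] by auto
  have ineq: "M * second_diff q b x0 (?t n) \<le> second_diff J b x0 (?t n)" if "b \<in> Basis" for b n
  proof -
    let ?s = "?t n"
    have "x0 + ?s *\<^sub>R b \<in> K" "x0 - ?s *\<^sub>R b \<in> K"
      using c(2) t[of n] that by (auto simp: dist_norm subset_iff)
    then have "M * (q (x0 + ?s *\<^sub>R b) + q (x0 - ?s *\<^sub>R b) - 2 * q x0)
        \<le> J (x0 + ?s *\<^sub>R b) + J (x0 - ?s *\<^sub>R b) - 2 * J x0"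
      using x0(2)[of "x0 + ?s *\<^sub>R b"] x0(2)[of "x0 - ?s *\<^sub>R b"] by (simp add: algebra_simps)
    then show ?thesis
      unfolding second_diff_def times_divide_eq_right by (rule divide_right_mono) simp
  qed
  let ?I = "\<lambda>b. \<integral>y. g y * partial b (partial b (bump \<rho> x0)) y \<partial>lborel"
  have le: "M * D b x0 \<le> ?I b" if "b \<in> Basis" for b
  proof (rule LIMSEQ_le)
    show "(\<lambda>n. M * second_diff q b x0 (?t n)) \<longlonglongrightarrow> M * D b x0"
      by (intro tendsto_mult_left filterlim_compose[OF D[OF x0_int that] t0])
    show "(\<lambda>n. second_diff J b x0 (?t n)) \<longlonglongrightarrow> ?I b"
      unfolding J_def using c(1) by (intro second_diff_mollify_tendsto[OF g \<rho>(1) that]) simp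
  qed (use ineq[OF that] in auto)
  have int: "integrable lborel (\<lambda>y. g y * partial b (partial b (bump \<rho> x0)) y)" if "b \<in> Basis" for b
  proof -
    have "continuous_on C (\<lambda>y. u y * partial b (partial b (bump \<rho> x0)) y)"
      by (intro continuous_intros uC continuous_on_subset[OF C_2_along_line(3)[OF C_k_on_bump that]]) simp
    from borel_integrable_compact[OF C(1) this] show ?thesis
      by (simp add: g_def mult.assoc)
  qed
  have "M * (\<Sum>b\<in>Basis. D b x0) \<le> (\<Sum>b\<in>Basis. ?I b)"
    unfolding sum_distrib_left by (rule sum_mono) (rule le)
  also have "\<dots> = (\<integral>y. g y * laplacian (bump \<rho> x0) y \<partial>lborel)"
    using int by (simp add: laplacian_def sum_distrib_left)
  also have "\<dots> = (LINT y:U|lborel. u y * laplacian (bump \<rho> x0) y)"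
    unfolding set_lebesgue_integral_def
  proof (rule Bochner_Integration.integral_cong)
    fix y
    show "g y * laplacian (bump \<rho> x0) y = indicat_real U y *\<^sub>R (u y * laplacian (bump \<rho> x0) y)"
    proof (cases "dist x0 y > \<rho>")
      case False
      then have "y \<in> C" using x0(1) \<rho>(2) by (force simp: C_def)
      then show ?thesis using C(2) by (auto simp: g_def)
    qed (simp add: laplacian_bump_eq_0[OF \<rho>(1)])
  qed simp
  also have "\<dots> \<le> 0"
  proof -
    have "cball x0 \<rho> \<subseteq> cball x0 d" using \<rho>(2) by (rule subset_cball)
    also have "\<dots> \<subseteq> U" using x0(1) d(2) by blast
    finally have "bump \<rho> x0 \<in> test_functions U"
      using bump_test_function[OF \<rho>(1)] by blast
    with U(3) show ?thesis
      unfolding distr_laplacian_nonpos_def using bump_nonneg by blast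
  qed
  finally show False
    using mult_pos_pos[OF M pos[OF x0_int]] by linarith
qed

section \<open>Superharmonic functions on a punctured neighbourhood\<close>

locale punctured_superharmonic =
  fixes \<Omega> :: "'a::euclidean_space set" and u :: "'a \<Rightarrow> real" and c :: real
  assumes dim: "DIM('a) \<ge> 2"
    and open_\<Omega>: "open \<Omega>"
    and zero_in: "0 \<in> \<Omega>"
    and cont: "continuous_on (\<Omega> - {0}) u"
    and superharmonic: "distr_laplacian_nonpos u (\<Omega> - {0})"
    and lower_bound: "\<And>y. y \<in> \<Omega> - {0} \<Longrightarrow> c \<le> u y"
begin

text \<open>
  The comparison principle is applied on the annulus \<open>s \<le> \<bar>z\<bar> \<le> r\<close> to \<open>h\<close> plus \<open>\<epsilon>\<close> times
  \<open>ln \<bar>z\<bar>\<^sup>2 + \<bar>z\<bar>\<^sup>2 - (ln r\<^sup>2 + r\<^sup>2)\<close>. The added function vanishes on the outer sphere. Its logarithm, which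
  has Laplacian \<open>2 (n - 2) / \<bar>z\<bar>\<^sup>2 \<ge> 0\<close>, pushes the sum below the lower bound of \<open>u\<close> on a small
  inner sphere, and the quadratic term makes the Laplacian strictly positive. Then \<open>\<epsilon> \<rightarrow> 0\<close>.
\<close>
lemma comparison_across_puncture:
  fixes h :: "'a \<Rightarrow> real"
  assumes r: "r > 0" "cball 0 r \<subseteq> \<Omega>"
    and h: "continuous_on (cball 0 r) h"
    and D: "\<And>x b. x \<in> ball 0 r \<Longrightarrow> b \<in> Basis \<Longrightarrow> (second_diff h b x \<longlongrightarrow> D b x) (at_right 0)"
    and harmonic: "\<And>x. x \<in> ball 0 r \<Longrightarrow> (\<Sum>b\<in>Basis. D b x) = 0"
    and sphere: "\<And>y. norm y = r \<Longrightarrow> h y \<le> u y"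
    and y: "norm y < r" "y \<noteq> 0"
  shows "h y \<le> u y"
proof -
  define L where "L = ln ((norm y)\<^sup>2) + (norm y)\<^sup>2 - (ln (r\<^sup>2) + r\<^sup>2)"
  have barrier: "h y + \<epsilon> * L \<le> u y" if \<epsilon>: "\<epsilon> > 0" for \<epsilon>
  proof -
    define q where "q = (\<lambda>z. h z + (\<epsilon> * (ln ((norm z)\<^sup>2) + (norm z)\<^sup>2) + - \<epsilon> * (ln (r\<^sup>2) + r\<^sup>2)))"
    obtain B where B: "\<And>z. z \<in> cball 0 r \<Longrightarrow> h z \<le> B"
      using compact_imp_bounded[OF compact_continuous_image[OF h compact_cball]]
      unfolding bounded_iff by (metis abs_le_D1 imageI real_norm_def)
    \<comment> \<open>Small enough that \<open>\<epsilon> (ln s\<^sup>2 - ln r\<^sup>2) \<le> c - B\<close>, so that the inner boundary condition holds.\<close>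
    define s where "s = min (norm y) (r * exp (- \<bar>B - c\<bar> / (2 * \<epsilon>)))"
    have s: "s > 0" "s \<le> norm y" "s < r" using r(1) y by (auto simp: s_def)
    have "ln s \<le> ln (r * exp (- \<bar>B - c\<bar> / (2 * \<epsilon>)))"
      using s(1) by (simp add: s_def)
    also have "\<dots> = ln r - \<bar>B - c\<bar> / (2 * \<epsilon>)"
      using r(1) by (simp add: ln_mult)
    finally have "\<epsilon> * (ln (s\<^sup>2) - ln (r\<^sup>2)) \<le> \<epsilon> * (- \<bar>B - c\<bar> / \<epsilon>)"
      using \<epsilon> s(1) r(1) by (intro mult_left_mono) (auto simp: ln_realpow field_simps)
    then have s_small: "\<epsilon> * (ln (s\<^sup>2) - ln (r\<^sup>2)) \<le> c - B"
      using \<epsilon> by simp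
    define K where "K = cball (0::'a) r - ball 0 s"
    have K_ne: "z \<noteq> 0" if "z \<in> K" for z using that s(1) by (auto simp: K_def)
    have int: "interior K \<subseteq> ball 0 r"
      using interior_mono[of K "cball 0 r"] by (auto simp: K_def)
    have bd: "norm z = r \<or> norm z = s" if z: "z \<in> K - interior K" for z
    proof (rule ccontr)
      assume "\<not> ?thesis"
      then have "z \<in> ball 0 r \<inter> - cball 0 s" using z by (auto simp: K_def)
      moreover have "ball 0 r \<inter> - cball 0 s \<subseteq> interior K"
        by (rule interior_maximal) (auto simp: K_def open_Compl open_Int)
      ultimately show False using z by blast
    qed
    have "q y \<le> u y"
    proof (rule comparison_principle[where U = "\<Omega> - {0}" and K = K
          and D = "\<lambda>b z. D b z + (\<epsilon> * ((2 / (norm z)\<^sup>2 - 4 * (z \<bullet> b)\<^sup>2 / (norm z) ^ 4) + 2) + 0)"])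
      show "open (\<Omega> - {0})" using open_\<Omega> by (rule open_Diff) simp
      show "compact K" unfolding K_def by (intro compact_diff) auto
      show "K \<subseteq> \<Omega> - {0}" using r(2) K_ne unfolding K_def by blast
      show "continuous_on K q"
        unfolding q_def using K_ne
        by (intro continuous_intros continuous_on_subset[OF h]) (auto simp: K_def)
      show "y \<in> K" using y s by (simp add: K_def)
      show "q z \<le> u z" if "z \<in> K - interior K" for z
        using bd[OF that]
      proof
        assume "norm z = r"
        then show ?thesis using sphere[of z] by (simp add: q_def)
      next
        assume z: "norm z = s"
        have "\<epsilon> * s\<^sup>2 \<le> \<epsilon> * r\<^sup>2" using \<epsilon> s by (intro mult_left_mono power_mono) auto
        then have "q z \<le> h z + \<epsilon> * (ln (s\<^sup>2) - ln (r\<^sup>2))" by (simp add: q_def z algebra_simps)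
        also have "\<dots> \<le> c" using s_small B[of z] that by (simp add: K_def)
        also have "\<dots> \<le> u z" using lower_bound[of z] that r(2) K_ne[of z] by (auto simp: K_def)
        finally show ?thesis .
      qed
      show "(second_diff q b z \<longlongrightarrow> D b z + (\<epsilon> * ((2 / (norm z)\<^sup>2 - 4 * (z \<bullet> b)\<^sup>2 / (norm z) ^ 4) + 2) + 0)) (at_right 0)"
        if z: "z \<in> interior K" and b: "b \<in> Basis" for z b
      proof -
        have z0: "z \<noteq> 0" using K_ne interior_subset z by blast
        have "\<forall>\<^sub>F t in at_right 0. 2 = second_diff (\<lambda>z. (norm z)\<^sup>2) b z t"
          unfolding eventually_at_right_field
          by (intro exI[of _ 1]) (simp add: second_diff_norm_sq[OF _ b])
        then have "(second_diff (\<lambda>z. (norm z)\<^sup>2) b z \<longlongrightarrow> 2) (at_right 0)"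
          by (rule Lim_transform_eventually[OF tendsto_const])
        then show ?thesis
          unfolding q_def second_diff_add second_diff_cmult second_diff_const
          using D[of z b] int z b second_diff_ln_norm_sq_tendsto[OF z0 b]
          by (intro tendsto_intros) auto
      qed
      show "(\<Sum>b\<in>Basis. D b z + (\<epsilon> * ((2 / (norm z)\<^sup>2 - 4 * (z \<bullet> b)\<^sup>2 / (norm z) ^ 4) + 2) + 0)) > 0"
        if z: "z \<in> interior K" for z
      proof -
        have z0: "z \<noteq> 0" using K_ne interior_subset z by blast
        have "(\<Sum>b\<in>Basis. 4 * (z \<bullet> b)\<^sup>2 / (norm z) ^ 4) = 4 / (norm z)\<^sup>2"
        proof -
          have "(\<Sum>b\<in>Basis. (z \<bullet> b)\<^sup>2) = (norm z)\<^sup>2"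
            by (simp only: power2_norm_eq_inner) (simp add: euclidean_inner[of z z] power2_eq_square)
          then show ?thesis
            using z0 by (simp add: sum_divide_distrib[symmetric] sum_distrib_left[symmetric] field_simps flip: power_add)
        qed
        moreover have "(\<Sum>b\<in>Basis. D b z + (\<epsilon> * ((2 / (norm z)\<^sup>2 - 4 * (z \<bullet> b)\<^sup>2 / (norm z) ^ 4) + 2) + 0))
            = (\<Sum>b\<in>Basis. D b z) + \<epsilon> * (real DIM('a) * (2 / (norm z)\<^sup>2)
                - (\<Sum>b\<in>Basis. 4 * (z \<bullet> b)\<^sup>2 / (norm z) ^ 4) + 2 * real DIM('a))"
          by (simp add: sum.distrib sum_subtractf flip: sum_distrib_left)
        moreover have "(\<Sum>b\<in>Basis. D b z) = 0" using harmonic int z by blast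
        ultimately have "(\<Sum>b\<in>Basis. D b z + (\<epsilon> * ((2 / (norm z)\<^sup>2 - 4 * (z \<bullet> b)\<^sup>2 / (norm z) ^ 4) + 2) + 0))
            = \<epsilon> * (2 * (real DIM('a) - 2) / (norm z)\<^sup>2 + 2 * real DIM('a))"
          by (simp add: diff_divide_distrib)
        also have "\<dots> > 0"
          using dim \<epsilon> by (intro mult_pos_pos add_nonneg_pos divide_nonneg_nonneg) auto
        finally show ?thesis .
      qed
    qed (use cont superharmonic in auto)
    then show ?thesis by (simp add: q_def L_def algebra_simps)
  qed
  have "((\<lambda>\<epsilon>. h y + \<epsilon> * L) \<longlongrightarrow> h y + 0 * L) (at_right 0)"
    by (intro tendsto_intros)
  moreover have "\<forall>\<^sub>F \<epsilon> in at_right 0. h y + \<epsilon> * L \<le> u y"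
    unfolding eventually_at_right_field using barrier by (intro exI[of _ 1]) auto
  ultimately show ?thesis
    using tendsto_upperbound[of "\<lambda>\<epsilon>. h y + \<epsilon> * L" "h y + 0 * L" "at_right 0" "u y"] by simp
qed

text \<open>
  The lower limit of \<open>u\<close> at the origin, which the last hypothesis bounds by \<open>l\<close>, acts as the value of
  \<open>u\<close> there: it dominates the value of any harmonic function lying below \<open>u\<close> on a sphere.
\<close>
lemma harmonic_minorant_at_0:
  fixes h :: "'a \<Rightarrow> real"
  assumes r: "r > 0" "cball 0 r \<subseteq> \<Omega>"
    and h: "continuous_on (cball 0 r) h"
    and D: "\<And>x b. x \<in> ball 0 r \<Longrightarrow> b \<in> Basis \<Longrightarrow> (second_diff h b x \<longlongrightarrow> D b x) (at_right 0)"
    and harmonic: "\<And>x. x \<in> ball 0 r \<Longrightarrow> (\<Sum>b\<in>Basis. D b x) = 0"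
    and sphere: "\<And>y. norm y = r \<Longrightarrow> h y \<le> u y"
    and near: "\<And>e. e > 0 \<Longrightarrow> \<exists>\<^sub>F y in at 0. u y < l + e"
  shows "h 0 \<le> l"
proof (rule ccontr)
  assume "\<not> h 0 \<le> l"
  then have e: "(h 0 - l) / 2 > 0" by simp
  have "continuous_on (ball 0 r) h" by (rule continuous_on_subset[OF h]) auto
  then have "isCont h 0" using r(1) by (simp add: continuous_on_eq_continuous_at)
  then have "\<forall>\<^sub>F y in at 0. l + (h 0 - l) / 2 < h y"
    using e by (intro order_tendstoD(1)[OF isContD]) (auto simp: field_simps)
  moreover have "\<forall>\<^sub>F y in at 0. y \<in> ball 0 r"
    using eventually_at_in_open'[of "ball 0 r" 0] r(1) by simp
  moreover have "\<forall>\<^sub>F y in at (0::'a). y \<noteq> 0"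
    by (simp add: eventually_at_filter)
  ultimately have "\<forall>\<^sub>F y in at 0. \<not> u y < l + (h 0 - l) / 2"
  proof eventually_elim
    case (elim y)
    then have "h y \<le> u y"
      by (intro comparison_across_puncture[OF r h D harmonic sphere]) auto
    with elim show ?case by simp
  qed
  with near[OF e] show False by (simp add: frequently_def)
qed

text \<open>
  Let the gradients be \<open>a + b\<close> and \<open>a - b\<close> with \<open>b \<noteq> 0\<close>, and let \<open>e = b / \<bar>b\<bar>\<close>. On a small sphere of radius \<open>r\<close>, \<open>u\<close> is at
  least \<open>l + a \<bullet> y + \<bar>b\<bar> \<bar>e \<bullet> y\<bar>\<close> up to an error \<open>\<eta> r\<close>, and \<open>\<bar>e \<bullet> y\<bar> \<ge> (e \<bullet> y)\<^sup>2 / r\<close>. Instead of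
  averaging this over the sphere, \<open>(e \<bullet> y)\<^sup>2\<close> is written as the harmonic polynomial
  \<open>(e \<bullet> y)\<^sup>2 - \<bar>y\<bar>\<^sup>2 / n\<close> plus the constant \<open>r\<^sup>2 / n\<close>. The resulting harmonic minorant has a value
  above \<open>l\<close> at the origin.
\<close>
lemma touching_gradients_eq:
  assumes p1: "(p1 has_derivative (\<lambda>y. a1 \<bullet> y)) (at 0)" "p1 0 = l"
    and p2: "(p2 has_derivative (\<lambda>y. a2 \<bullet> y)) (at 0)" "p2 0 = l"
    and below: "\<forall>\<^sub>F y in at 0. p1 y \<le> u y \<and> p2 y \<le> u y"
    and near: "\<And>e. e > 0 \<Longrightarrow> \<exists>\<^sub>F y in at 0. u y < l + e"
  shows "a1 = a2"
proof (rule ccontr)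
  assume "a1 \<noteq> a2"
  define a b where "a = (1/2) *\<^sub>R (a1 + a2)" and "b = (1/2) *\<^sub>R (a1 - a2)"
  define e where "e = (1 / norm b) *\<^sub>R b"
  let ?n = "real DIM('a)"
  have ab: "a1 = a + b" "a2 = a - b"
    unfolding a_def b_def scaleR_add_right scaleR_diff_right by (simp_all add: scaleR_left.add[symmetric] flip: scaleR_2)
  have b: "norm b > 0" using \<open>a1 \<noteq> a2\<close> by (simp add: b_def)
  have e: "norm e = 1" and be: "b = norm b *\<^sub>R e" using b by (auto simp: e_def)
  \<comment> \<open>The gain at the origin is \<open>\<bar>b\<bar> r / n\<close>; the error \<open>\<eta> r\<close> consumes half of it.\<close>
  define \<eta> where "\<eta> = norm b / (2 * ?n)"
  have \<eta>: "\<eta> > 0" using b by (simp add: \<eta>_def)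
  from p1 \<eta> obtain d1 where d1: "d1 > 0" "\<And>y. norm y < d1 \<Longrightarrow> \<bar>p1 y - l - a1 \<bullet> y\<bar> \<le> \<eta> * norm y"
    unfolding has_derivative_at_alt by fastforce
  from p2 \<eta> obtain d2 where d2: "d2 > 0" "\<And>y. norm y < d2 \<Longrightarrow> \<bar>p2 y - l - a2 \<bullet> y\<bar> \<le> \<eta> * norm y"
    unfolding has_derivative_at_alt by fastforce
  from below obtain d3 where d3: "d3 > 0" "\<And>y. y \<noteq> 0 \<Longrightarrow> norm y < d3 \<Longrightarrow> p1 y \<le> u y \<and> p2 y \<le> u y"
    unfolding eventually_at by auto
  obtain d4 where d4: "d4 > 0" "cball 0 d4 \<subseteq> \<Omega>"
    using open_\<Omega> zero_in open_contains_cball by blast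
  define r where "r = min (min d1 d2) (min d3 d4) / 2"
  have r: "r > 0" "r < d1" "r < d2" "r < d3" "r \<le> d4"
    using d1(1) d2(1) d3(1) d4(1) by (auto simp: r_def)
  define h where "h = (\<lambda>y. (l + \<eta> * r) + (a \<bullet> y + (norm b / (?n * r)) * (?n * (e \<bullet> y)\<^sup>2 + - 1 * (norm y)\<^sup>2)))"
  have "h 0 \<le> l"
  proof (rule harmonic_minorant_at_0[where r = r and h = h and
        D = "\<lambda>b' y. 0 + (0 + (norm b / (?n * r)) * (?n * (2 * (e \<bullet> b')\<^sup>2) + - 1 * 2))"])
    show "cball 0 r \<subseteq> \<Omega>" using d4(2) r(5) by auto
    show "continuous_on (cball 0 r) h" unfolding h_def by (intro continuous_intros)
    show "(second_diff h b' y \<longlongrightarrow> 0 + (0 + (norm b / (?n * r)) * (?n * (2 * (e \<bullet> b')\<^sup>2) + - 1 * 2))) (at_right 0)"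
      if "b' \<in> Basis" for b' y
    proof (rule Lim_transform_eventually[OF tendsto_const])
      show "\<forall>\<^sub>F t in at_right 0. 0 + (0 + (norm b / (?n * r)) * (?n * (2 * (e \<bullet> b')\<^sup>2) + - 1 * 2)) = second_diff h b' y t"
        unfolding eventually_at_right_field h_def second_diff_add second_diff_cmult second_diff_const second_diff_inner
        by (intro exI[of _ 1]) (simp add: second_diff_norm_sq[OF _ that] second_diff_inner_sq)
    qed
    have "(\<Sum>b\<in>Basis. (e \<bullet> b)\<^sup>2) = 1"
      using e euclidean_inner[of e e] by (simp add: power2_eq_square norm_eq_1)
    then show "(\<Sum>b'\<in>Basis. 0 + (0 + (norm b / (?n * r)) * (?n * (2 * (e \<bullet> b')\<^sup>2) + - 1 * 2))) = 0"
      by (simp add: sum_divide_distrib[symmetric] sum_distrib_left[symmetric] sum_subtractf)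
    show "h y \<le> u y" if y: "norm y = r" for y
    proof -
      define w where "w = e \<bullet> y"
      have w: "\<bar>w\<bar> \<le> r" using Cauchy_Schwarz_ineq2[of e y] e y by (simp add: w_def)
      have bw: "b \<bullet> y = norm b * w" by (subst be) (simp add: w_def)
      have y0: "y \<noteq> 0" using y r(1) by auto
      have "l + (a \<bullet> y + norm b * w) - \<eta> * r \<le> u y"
        using d1(2)[of y] d3(2)[OF y0] y r by (auto simp: ab inner_add_left bw abs_le_iff)
      moreover have "l + (a \<bullet> y - norm b * w) - \<eta> * r \<le> u y"
        using d2(2)[of y] d3(2)[OF y0] y r by (auto simp: ab inner_diff_left bw abs_le_iff)
      ultimately have "l + a \<bullet> y + norm b * \<bar>w\<bar> - \<eta> * r \<le> u y"
        by (cases "w \<ge> 0") auto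
      moreover have "norm b * w\<^sup>2 / r \<le> norm b * \<bar>w\<bar>"
      proof -
        have "\<bar>w\<bar> * \<bar>w\<bar> \<le> \<bar>w\<bar> * r" using w by (intro mult_left_mono) auto
        then show ?thesis using b r(1) by (simp add: field_simps power2_eq_square)
      qed
      moreover have "h y = l + a \<bullet> y + norm b * w\<^sup>2 / r - \<eta> * r"
        using r(1) by (simp add: h_def w_def[symmetric] y \<eta>_def field_simps power2_eq_square)
      ultimately show ?thesis by linarith
    qed
  qed (use r near in auto)
  moreover have "h 0 > l" using \<eta> r(1) by (simp add: h_def)
  ultimately show False by simp
qed

end

section \<open>Touching parameters\<close>

lemma compact_positive_lower_bound:
  fixes f :: "'a::topological_space \<Rightarrow> real"
  assumes "compact S" "continuous_on S f" "\<And>x. x \<in> S \<Longrightarrow> f x > 0"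
  obtains m where "m > 0" "\<And>x. x \<in> S \<Longrightarrow> m \<le> f x"
proof (cases "S = {}")
  case False
  with continuous_attains_inf[OF assms(1) _ assms(2)] assms(3) that show ?thesis by blast
qed (use that[of 1] in auto)

text \<open>
  An intermediate value theorem for the infimum of a family: equicontinuity of the family makes the
  infimum continuous in the parameter. The last parameter at which the family is nonnegative is the
  required one.
\<close>
lemma INF_eq_0_attained:
  fixes G :: "real \<Rightarrow> 'b \<Rightarrow> real"
  assumes "a \<le> b"
    and equicont: "\<And>e. e > 0 \<Longrightarrow> \<exists>d>0. \<forall>s\<in>{a..b}. \<forall>t\<in>{a..b}. \<bar>s - t\<bar> < d \<longrightarrow> (\<forall>y\<in>Y. \<bar>G s y - G t y\<bar> \<le> e)"
    and left: "\<And>y. y \<in> Y \<Longrightarrow> 0 \<le> G a y"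
    and right: "\<exists>y\<in>Y. G b y < 0"
  shows "\<exists>t\<in>{a..b}. (INF y\<in>Y. ereal (G t y)) = 0"
proof -
  define S where "S = {t \<in> {a..b}. \<forall>y\<in>Y. 0 \<le> G t y}"
  have S: "a \<in> S" "bdd_above S"
    using \<open>a \<le> b\<close> left by (simp add: S_def, intro bdd_aboveI[of S b], simp add: S_def)
  define t where "t = Sup S"
  have t: "t \<in> {a..b}"
  proof -
    have "Sup S \<le> b" using S(1) by (intro cSup_least) (auto simp: S_def)
    with cSup_upper[OF S] show ?thesis by (simp add: t_def)
  qed
  have nonneg: "0 \<le> G t y" if y: "y \<in> Y" for y
  proof (rule ccontr)
    assume neg: "\<not> 0 \<le> G t y"
    then have "- G t y / 2 > 0" by simp
    from equicont[OF this] obtain d where d: "d > 0"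
      "\<And>s. s \<in> {a..b} \<Longrightarrow> \<bar>s - t\<bar> < d \<Longrightarrow> \<bar>G s y - G t y\<bar> \<le> - G t y / 2"
      using t y by blast
    obtain s where s: "s \<in> S" "t - d < s"
      using less_cSup_iff[of S "t - d"] S d(1) by (auto simp: t_def)
    have "s \<le> t" using cSup_upper[OF s(1) S(2)] by (simp add: t_def)
    with d(2)[of s] s have "G s y \<le> G t y / 2" by (auto simp: S_def abs_le_iff)
    moreover have "0 \<le> G s y" using s(1) y by (auto simp: S_def)
    ultimately show False using neg by simp
  qed
  have small: "\<exists>y\<in>Y. G t y < e" if e: "e > 0" for e
  proof (rule ccontr)
    assume "\<not> (\<exists>y\<in>Y. G t y < e)"
    then have ge: "e \<le> G t y" if "y \<in> Y" for y using that by force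
    with right e have "t \<noteq> b" by force
    from equicont[OF e] obtain d where d: "d > 0"
      "\<And>s y. s \<in> {a..b} \<Longrightarrow> y \<in> Y \<Longrightarrow> \<bar>s - t\<bar> < d \<Longrightarrow> \<bar>G s y - G t y\<bar> \<le> e"
      using t by blast
    define s where "s = min b (t + d / 2)"
    have s: "s \<in> {a..b}" "t < s" "\<bar>s - t\<bar> < d"
      using t \<open>t \<noteq> b\<close> d(1) by (auto simp: s_def)
    have "0 \<le> G s y" if "y \<in> Y" for y
      using d(2)[OF s(1) that s(3)] ge[OF that] by linarith
    then have "s \<in> S" using s(1) by (simp add: S_def)
    then show False using cSup_upper[OF _ S(2)] s(2) by (force simp: t_def)
  qed
  have "(INF y\<in>Y. ereal (G t y)) \<le> 0"
  proof (rule ccontr)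
    assume "\<not> ?thesis"
    then obtain e where e: "0 < ereal e" "ereal e < (INF y\<in>Y. ereal (G t y))"
      using ereal_dense2[of 0 "INF y\<in>Y. ereal (G t y)"] by (auto simp: not_le)
    then obtain y where "y \<in> Y" "G t y < e" using small[of e] by auto
    then have "(INF y\<in>Y. ereal (G t y)) < ereal e" by (metis INF_lower le_less_trans less_ereal.simps(1))
    with e(2) show False by simp
  qed
  moreover have "0 \<le> (INF y\<in>Y. ereal (G t y))"
    using nonneg by (intro INF_greatest) simp
  ultimately have "(INF y\<in>Y. ereal (G t y)) = 0" by (rule antisym)
  with t show ?thesis by blast
qed

lemma deriv_pos_linear_bounds:
  fixes \<phi> :: "real \<Rightarrow> real"
  assumes "(\<phi> has_real_derivative a) (at 1)" "a > 0" "\<phi> 1 = 1"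
  obtains \<kappa> where "\<kappa> > 0" 
    "\<And>s. 0 < s \<Longrightarrow> s < \<kappa> \<Longrightarrow> \<phi> (1 - s) \<le> 1 - a / 2 * s"
    "\<And>s. 0 < s \<Longrightarrow> s < \<kappa> \<Longrightarrow> 1 + a / 2 * s \<le> \<phi> (1 + s)"
proof -
  have "a / 2 > 0" using assms(2) by simp
  then obtain \<kappa> where \<kappa>: "\<kappa> > 0" "\<And>y. \<bar>y - 1\<bar> < \<kappa> \<Longrightarrow> \<bar>\<phi> y - 1 - a * (y - 1)\<bar> \<le> a / 2 * \<bar>y - 1\<bar>"
    using assms(1,3) unfolding has_field_derivative_def has_derivative_at_alt real_norm_def by metis
  show thesis
  proof (rule that[OF \<kappa>(1)])
    fix s :: real assume s: "0 < s" "s < \<kappa>"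
    have "\<bar>\<phi> (1 - s) - 1 + a * s\<bar> \<le> a / 2 * s" using \<kappa>(2)[of "1 - s"] s by simp
    then show "\<phi> (1 - s) \<le> 1 - a / 2 * s" by linarith
    have "\<bar>\<phi> (1 + s) - 1 - a * s\<bar> \<le> a / 2 * s" using \<kappa>(2)[of "1 + s"] s by simp
    then show "1 + a / 2 * s \<le> \<phi> (1 + s)" by linarith
  qed
qed

text \<open>
  \<open>v_phi\<close> is continuous jointly in both parameters and the point, hence uniformly so on a compact set
  of parameters and points that is small enough for all arguments to stay in the domains of \<open>\<phi>\<close> and \<open>v\<close>.
\<close>
lemma uniformly_continuous_v_phi:
  fixes v :: "'a::euclidean_space \<Rightarrow> real"
  assumes C: "compact C" and N: "open N" "C \<subseteq> N" "continuous_on N v"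
    and I: "open I" "1 \<in> I" "continuous_on I \<phi>"
  obtains \<alpha> where "0 < \<alpha>" and
    "\<And>e. 0 < e \<Longrightarrow> \<exists>d>0. \<forall>s t x z y. \<bar>s - 1\<bar> \<le> \<alpha> \<longrightarrow> \<bar>t - 1\<bar> \<le> \<alpha> \<longrightarrow> norm x \<le> \<alpha> \<longrightarrow> norm z \<le> \<alpha> \<longrightarrow> y \<in> C \<longrightarrow>
        \<bar>s - t\<bar> < d \<longrightarrow> norm (x - z) < d \<longrightarrow> \<bar>v_phi \<phi> v x s y - v_phi \<phi> v z t y\<bar> < e"
proof -
  obtain R where R: "R > 0" "\<And>y. y \<in> C \<Longrightarrow> norm y \<le> R"
    using compact_imp_bounded[OF C] unfolding bounded_pos by blast
  obtain d0 where d0: "d0 > 0" "(\<Union>y\<in>C. cball y d0) \<subseteq> N"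
    using compact_subset_open_imp_cball_epsilon_subset[OF C N(1,2)] by blast
  obtain k where k: "k > 0" "cball 1 k \<subseteq> I"
    using I(1,2) open_contains_cball by blast
  define \<alpha> where "\<alpha> = min k (d0 / (1 + R))"
  have \<alpha>: "\<alpha> > 0" "\<alpha> \<le> k" "\<alpha> \<le> d0 / (1 + R)"
    using k d0 R(1) by (auto simp: \<alpha>_def)
  then have \<alpha>R: "\<alpha> * (1 + R) \<le> d0" using R(1) by (simp add: pos_le_divide_eq)
  define P where "P = cball (1::real) \<alpha> \<times> (cball (0::'a) \<alpha> \<times> C)"
  define H where "H = (\<lambda>p. \<phi> (fst p) * v (fst (snd p) + fst p *\<^sub>R snd (snd p)))"
  have P: "compact P" unfolding P_def by (intro compact_Times C compact_cball)
  have argI: "fst p \<in> I" if "p \<in> P" for p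
    using that k(2) \<alpha>(2) by (auto simp: P_def)
  have argN: "fst (snd p) + fst p *\<^sub>R snd (snd p) \<in> N" if "p \<in> P" for p
  proof -
    obtain s x y where p: "p = (s, x, y)" by (metis prod.collapse)
    have s: "\<bar>s - 1\<bar> \<le> \<alpha>" and x: "norm x \<le> \<alpha>" and y: "y \<in> C"
      using that by (auto simp: P_def p dist_real_def abs_minus_commute)
    have "norm (x + (s - 1) *\<^sub>R y) \<le> norm x + \<bar>s - 1\<bar> * norm y"
      using norm_triangle_ineq[of x "(s - 1) *\<^sub>R y"] by simp
    also have "\<dots> \<le> \<alpha> + \<alpha> * R"
      using s x R(2)[OF y] \<alpha>(1) by (intro add_mono mult_mono) auto
    finally have "norm (x + (s - 1) *\<^sub>R y) \<le> d0" using \<alpha>R by (simp add: algebra_simps)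
    then have "x + s *\<^sub>R y \<in> cball y d0"
      by (simp add: dist_norm norm_minus_commute[of y] algebra_simps)
    then have "x + s *\<^sub>R y \<in> N" using d0(2) y by blast
    then show ?thesis by (simp add: p)
  qed
  have "continuous_on P H"
    unfolding H_def
    by (intro continuous_intros continuous_on_compose2[OF I(3)] continuous_on_compose2[OF N(3)])
      (use argI argN in auto)
  then have uc: "uniformly_continuous_on P H" using P by (rule compact_uniformly_continuous)
  show thesis
  proof (rule that[OF \<alpha>(1)])
    fix e :: real assume "e > 0"
    with uc obtain d where d: "d > 0" "\<And>p p'. p \<in> P \<Longrightarrow> p' \<in> P \<Longrightarrow> dist p' p < d \<Longrightarrow> dist (H p') (H p) < e"
      unfolding uniformly_continuous_on_def by metis
    show "\<exists>d>0. \<forall>s t x z y. \<bar>s - 1\<bar> \<le> \<alpha> \<longrightarrow> \<bar>t - 1\<bar> \<le> \<alpha> \<longrightarrow> norm x \<le> \<alpha> \<longrightarrow> norm z \<le> \<alpha> \<longrightarrow> y \<in> C \<longrightarrow>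
        \<bar>s - t\<bar> < d \<longrightarrow> norm (x - z) < d \<longrightarrow> \<bar>v_phi \<phi> v x s y - v_phi \<phi> v z t y\<bar> < e"
    proof (intro exI[of _ "d / 2"] conjI allI impI)
      fix s t :: real and x z y :: 'a
      assume a: "\<bar>s - 1\<bar> \<le> \<alpha>" "\<bar>t - 1\<bar> \<le> \<alpha>" "norm x \<le> \<alpha>" "norm z \<le> \<alpha>" "y \<in> C"
        and b: "\<bar>s - t\<bar> < d / 2" "norm (x - z) < d / 2"
      have "(s, x, y) \<in> P" "(t, z, y) \<in> P"
        using a by (auto simp: P_def dist_real_def abs_minus_commute)
      moreover have "dist (s, x, y) (t, z, y) < d"
      proof -
        have "dist (s, x, y) (t, z, y) \<le> dist s t + dist x z"
          by (simp add: dist_Pair_Pair sqrt_sum_squares_le_sum)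
        also have "\<dots> < d" using b by (simp add: dist_real_def dist_norm)
        finally show ?thesis .
      qed
      ultimately have "dist (H (s, x, y)) (H (t, z, y)) < e" by (intro d(2))
      then show "\<bar>v_phi \<phi> v x s y - v_phi \<phi> v z t y\<bar> < e"
        by (simp add: H_def v_phi_def dist_real_def)
    qed (use d(1) in simp)
  qed
qed

text \<open>
  For \<open>\<lambda> = 1 - \<epsilon>'\<close> the shifted function stays below \<open>v\<close> near the origin: the factor \<open>\<phi> \<lambda>\<close> gains a multiple of
  \<open>\<epsilon>'\<close>, while the change of the argument costs at most \<open>2 L \<epsilon>' r0\<close> in the ball of radius \<open>r0\<close>, which is
  less if \<open>r0\<close> is small. Outside that ball \<open>u - v\<close> is bounded away from zero, and it suffices that the
  parameters are close to \<open>(0, 1)\<close>. It is essential that \<open>r0\<close> does not depend on \<open>\<epsilon>'\<close>.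
  For \<open>\<lambda> = 1 + \<epsilon>'\<close> the shifted function exceeds \<open>v 0\<close> near the origin, hence also
  \<open>u\<close> at some points. In between, the infimum vanishes.
\<close>
lemma exists_touching_parameter:
  fixes u v :: "'a::euclidean_space \<Rightarrow> real"
  assumes \<Omega>: "open \<Omega>" "bounded \<Omega>" "0 \<in> \<Omega>"
    and I: "open I" "1 \<in> I" "continuous_on I \<phi>"
    and \<phi>: "\<phi> 1 = 1" "(\<phi> has_real_derivative a) (at 1)" "a > 0"
    and N: "open N" "closure \<Omega> \<subseteq> N" "continuous_on N v"
    and lip: "\<rho> > 0" "L \<ge> 0" "\<And>x y. norm x < \<rho> \<Longrightarrow> norm y < \<rho> \<Longrightarrow> \<bar>v x - v y\<bar> \<le> L * norm (x - y)"
    and u: "continuous_on (closure \<Omega> - {0}) u"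
    and v_pos: "\<And>x. x \<in> closure \<Omega> \<Longrightarrow> v x > 0"
    and uv: "\<And>x. x \<in> closure \<Omega> - {0} \<Longrightarrow> u x > v x"
    and near: "\<And>e. e > 0 \<Longrightarrow> \<exists>\<^sub>F y in at 0. u y < v 0 + e"
    and \<epsilon>: "\<epsilon> > 0"
  shows "\<exists>\<delta>>0. \<forall>x. norm x < \<delta> \<longrightarrow>
    (\<exists>lam. \<bar>lam - 1\<bar> < \<epsilon> \<and> (INF y\<in>\<Omega> - {0}. ereal (u y - v_phi \<phi> v x lam y)) = 0)"
proof -
  have C: "compact (closure \<Omega>)" using \<Omega>(2) by simp
  have \<Omega>C: "\<Omega> \<subseteq> closure \<Omega>" by (rule closure_subset)
  have vC: "continuous_on (closure \<Omega>) v" using N(2,3) continuous_on_subset by blast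
  obtain \<alpha> where \<alpha>: "\<alpha> > 0" and UC:
    "\<And>e. 0 < e \<Longrightarrow> \<exists>d>0. \<forall>s t x z y. \<bar>s - 1\<bar> \<le> \<alpha> \<longrightarrow> \<bar>t - 1\<bar> \<le> \<alpha> \<longrightarrow> norm x \<le> \<alpha> \<longrightarrow> norm z \<le> \<alpha> \<longrightarrow> y \<in> closure \<Omega> \<longrightarrow>
        \<bar>s - t\<bar> < d \<longrightarrow> norm (x - z) < d \<longrightarrow> \<bar>v_phi \<phi> v x s y - v_phi \<phi> v z t y\<bar> < e"
    using uniformly_continuous_v_phi[OF C N I] by blast
  obtain \<kappa> where \<kappa>: "\<kappa> > 0" 
    "\<And>s. 0 < s \<Longrightarrow> s < \<kappa> \<Longrightarrow> \<phi> (1 - s) \<le> 1 - a / 2 * s"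
    "\<And>s. 0 < s \<Longrightarrow> s < \<kappa> \<Longrightarrow> 1 + a / 2 * s \<le> \<phi> (1 + s)"
    using deriv_pos_linear_bounds[OF \<phi>(2,3,1)] by blast
  obtain m where m: "m > 0" "\<And>x. x \<in> closure \<Omega> \<Longrightarrow> m \<le> v x"
    using compact_positive_lower_bound[OF C vC v_pos] by blast
  obtain r1 where r1: "r1 > 0" "cball 0 r1 \<subseteq> \<Omega>"
    using \<Omega>(1,3) open_contains_cball by blast
  \<comment> \<open>The second bound gives \<open>2 L \<epsilon> r0 \<le> (a / 2) \<epsilon> m\<close>, so that the loss from moving the argument is covered by the gain of the factor.\<close>
  define r0 where "r0 = min (min r1 \<rho> / 3) (a * m / (4 * (L + 1)))"
  have r0: "r0 > 0" "2 * r0 < \<rho>" "2 * r0 \<le> r1"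
    using r1(1) lip(1,2) \<phi>(3) m(1) by (auto simp: r0_def)
  have "r0 \<le> a * m / (4 * (L + 1))" by (simp add: r0_def)
  then have "4 * (L + 1) * r0 \<le> a * m"
    using lip(2) by (simp add: pos_le_divide_eq mult.commute[of r0])
  then have r0_L: "4 * L * r0 \<le> a * m" using r0(1) by (simp add: algebra_simps)
  obtain \<delta>0 where \<delta>0: "\<delta>0 > 0" "\<And>y. y \<in> closure \<Omega> - ball 0 r0 \<Longrightarrow> \<delta>0 \<le> u y - v y"
  proof (rule compact_positive_lower_bound[of "closure \<Omega> - ball 0 r0" "\<lambda>y. u y - v y"])
    show "compact (closure \<Omega> - ball 0 r0)" using C by (rule compact_diff) simp
    show "continuous_on (closure \<Omega> - ball 0 r0) (\<lambda>y. u y - v y)"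
      using r0(1) by (intro continuous_intros continuous_on_subset[OF u] continuous_on_subset[OF vC]) auto
    show "u y - v y > 0" if "y \<in> closure \<Omega> - ball 0 r0" for y
      using uv[of y] that r0(1) by (cases "y = 0") auto
  qed blast
  obtain d1 where d1: "d1 > 0" "\<And>s t x z y. \<bar>s - 1\<bar> \<le> \<alpha> \<Longrightarrow> \<bar>t - 1\<bar> \<le> \<alpha> \<Longrightarrow> norm x \<le> \<alpha> \<Longrightarrow> norm z \<le> \<alpha> \<Longrightarrow> y \<in> closure \<Omega> \<Longrightarrow>
        \<bar>s - t\<bar> < d1 \<Longrightarrow> norm (x - z) < d1 \<Longrightarrow> \<bar>v_phi \<phi> v x s y - v_phi \<phi> v z t y\<bar> < \<delta>0"
    using UC[OF \<delta>0(1)] by blast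
  define \<epsilon>' where "\<epsilon>' = min (min (\<epsilon> / 2) \<alpha>) (min (min (\<kappa> / 2) (d1 / 2)) (1 / 2))"
  have \<epsilon>': "\<epsilon>' > 0" "\<epsilon>' < \<epsilon>" "\<epsilon>' \<le> \<alpha>" "\<epsilon>' < \<kappa>" "\<epsilon>' < d1" "\<epsilon>' < 1"
    using \<epsilon> \<alpha> \<kappa>(1) d1(1) by (auto simp: \<epsilon>'_def)
  have v0: "v 0 > 0" using v_pos \<Omega>(3) \<Omega>C by blast
  define \<tau> where "\<tau> = a / 2 * \<epsilon>'"
  have \<tau>: "\<tau> > 0" using \<epsilon>'(1) \<phi>(3) by (simp add: \<tau>_def)
  \<comment> \<open>Solves \<open>v 0 + e < (1 + \<tau>) (v 0 - e)\<close>, which amounts to \<open>e (2 + \<tau>) < \<tau> v 0\<close>.\<close>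
  define e where "e = \<tau> * v 0 / (2 * (2 + \<tau>))"
  have e: "e > 0" "e * (2 * (2 + \<tau>)) = \<tau> * v 0" using \<tau> v0 by (auto simp: e_def)
  have "\<tau> * e > 0" using \<tau> e(1) by simp
  with e have e2: "v 0 + e < (1 + \<tau>) * (v 0 - e)" by (simp add: algebra_simps)
  then have e3: "v 0 - e > 0"
    using zero_less_mult_pos[of "1 + \<tau>" "v 0 - e"] e(1) v0 \<tau> by linarith
  define \<sigma> where "\<sigma> = min \<rho> (e / (L + 1))"
  have \<sigma>: "\<sigma> > 0" using lip(1,2) e(1) by (simp add: \<sigma>_def)
  have \<sigma>v: "v 0 - e \<le> v z" if z: "norm z < \<sigma>" for z
  proof -
    have "(L + 1) * norm z \<le> e" using z lip(2) by (simp add: \<sigma>_def pos_less_divide_eq mult.commute)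
    then have "L * norm z \<le> e" using norm_ge_zero[of z] unfolding distrib_right by linarith
    moreover have "\<bar>v z - v 0\<bar> \<le> L * norm z" using lip(3)[of z 0] lip(1) z by (simp add: \<sigma>_def)
    ultimately show ?thesis by linarith
  qed
  define \<delta> where "\<delta> = min (min (\<epsilon>' * r0) d1) (min \<alpha> (\<sigma> / 2))"
  have \<delta>: "\<delta> > 0" "\<delta> \<le> \<epsilon>' * r0" "\<delta> \<le> d1" "\<delta> \<le> \<alpha>" "\<delta> \<le> \<sigma> / 2"
    using \<epsilon>'(1) r0(1) d1(1) \<alpha> \<sigma> by (auto simp: \<delta>_def)
  show ?thesis
  proof (rule exI[of _ \<delta>], intro conjI allI impI)
    fix x :: 'a assume x: "norm x < \<delta>"
    have "\<exists>t\<in>{1 - \<epsilon>'..1 + \<epsilon>'}. (INF y\<in>\<Omega> - {0}. ereal (u y - v_phi \<phi> v x t y)) = 0"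
    proof (rule INF_eq_0_attained)
      show "1 - \<epsilon>' \<le> 1 + \<epsilon>'" using \<epsilon>'(1) by simp
      show "\<exists>d>0. \<forall>s\<in>{1 - \<epsilon>'..1 + \<epsilon>'}. \<forall>t\<in>{1 - \<epsilon>'..1 + \<epsilon>'}. \<bar>s - t\<bar> < d \<longrightarrow>
          (\<forall>y\<in>\<Omega> - {0}. \<bar>(u y - v_phi \<phi> v x s y) - (u y - v_phi \<phi> v x t y)\<bar> \<le> e)" if e_pos: "e > 0" for e
      proof -
        obtain d where d: "d > 0" "\<And>s t x z y. \<bar>s - 1\<bar> \<le> \<alpha> \<Longrightarrow> \<bar>t - 1\<bar> \<le> \<alpha> \<Longrightarrow> norm x \<le> \<alpha> \<Longrightarrow> norm z \<le> \<alpha> \<Longrightarrow> y \<in> closure \<Omega> \<Longrightarrow>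
            \<bar>s - t\<bar> < d \<Longrightarrow> norm (x - z) < d \<Longrightarrow> \<bar>v_phi \<phi> v x s y - v_phi \<phi> v z t y\<bar> < e"
          using UC[OF e_pos] by blast
        show ?thesis
        proof (intro exI[of _ d] conjI ballI impI d(1))
          fix s t y assume "s \<in> {1 - \<epsilon>'..1 + \<epsilon>'}" "t \<in> {1 - \<epsilon>'..1 + \<epsilon>'}" "\<bar>s - t\<bar> < d" "y \<in> \<Omega> - {0}"
          then have "\<bar>v_phi \<phi> v x s y - v_phi \<phi> v x t y\<bar> < e"
            using x \<epsilon>'(3) \<delta>(4) \<Omega>C d(1) by (intro d(2)) auto
          then show "\<bar>(u y - v_phi \<phi> v x s y) - (u y - v_phi \<phi> v x t y)\<bar> \<le> e" by linarith
        qed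
      qed
      show "0 \<le> u y - v_phi \<phi> v x (1 - \<epsilon>') y" if y: "y \<in> \<Omega> - {0}" for y
      proof (cases "norm y < r0")
        case False
        then have "\<delta>0 \<le> u y - v y" using y \<Omega>C by (intro \<delta>0(2)) auto
        moreover have "\<bar>v_phi \<phi> v x (1 - \<epsilon>') y - v_phi \<phi> v 0 1 y\<bar> < \<delta>0"
          using x \<epsilon>' \<delta> y \<Omega>C \<alpha> by (intro d1(2)) auto
        moreover have "v_phi \<phi> v 0 1 y = v y" by (simp add: v_phi_def \<phi>(1))
        ultimately show ?thesis by linarith
      next
        case True
        define z where "z = x + (1 - \<epsilon>') *\<^sub>R y"
        have "norm z \<le> norm x + (1 - \<epsilon>') * norm y"
          using norm_triangle_ineq[of x "(1 - \<epsilon>') *\<^sub>R y"] \<epsilon>'(6) by (simp add: z_def)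
        also have "(1 - \<epsilon>') * norm y \<le> (1 - \<epsilon>') * r0"
          using True \<epsilon>'(6) by (intro mult_left_mono) auto
        finally have "norm z \<le> r0" using x \<delta>(2) by (simp add: algebra_simps)
        have "z \<in> \<Omega>" using \<open>norm z \<le> r0\<close> r0 r1(2) by auto
        have mz: "m \<le> v z" using \<open>z \<in> \<Omega>\<close> \<Omega>C by (intro m(2)) auto
        have "norm (y - z) \<le> norm x + \<epsilon>' * norm y"
        proof -
          have "y - z = \<epsilon>' *\<^sub>R y - x" by (simp add: z_def algebra_simps)
          then show ?thesis using norm_triangle_ineq4[of "\<epsilon>' *\<^sub>R y" x] \<epsilon>'(1) by simp
        qed
        also have "\<epsilon>' * norm y \<le> \<epsilon>' * r0" using True \<epsilon>'(1) by (intro mult_left_mono) auto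
        finally have "norm (y - z) \<le> 2 * (\<epsilon>' * r0)" using x \<delta>(2) by linarith
        then have "L * norm (y - z) \<le> L * (2 * (\<epsilon>' * r0))" using lip(2) by (rule mult_left_mono)
        moreover have "\<bar>v y - v z\<bar> \<le> L * norm (y - z)"
          using lip(3)[of y z] True \<open>norm z \<le> r0\<close> r0 by simp
        ultimately have "v z - v y \<le> L * (2 * (\<epsilon>' * r0))" by linarith
        also have "\<dots> \<le> \<tau> * m"
          using mult_left_mono[OF r0_L, of "\<epsilon>' / 2"] \<epsilon>'(1) by (simp add: \<tau>_def algebra_simps)
        also have "\<dots> \<le> \<tau> * v z" using \<tau> mz by (intro mult_left_mono) auto
        also have "\<dots> \<le> (1 - \<phi> (1 - \<epsilon>')) * v z"
          using \<kappa>(2)[of \<epsilon>'] \<epsilon>' mz m(1) by (intro mult_right_mono) (auto simp: \<tau>_def)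
        finally have "v_phi \<phi> v x (1 - \<epsilon>') y \<le> v y" by (simp add: v_phi_def z_def algebra_simps)
        then show ?thesis using uv[of y] y \<Omega>C by auto
      qed
      show "\<exists>y\<in>\<Omega> - {0}. u y - v_phi \<phi> v x (1 + \<epsilon>') y < 0"
      proof -
        have "\<forall>\<^sub>F y in at 0. y \<in> \<Omega> \<inter> ball 0 (\<sigma> / 4) - {0}"
          using \<Omega>(1,3) \<sigma> by (intro eventually_at_in_open) auto
        with near[OF e(1)] have "\<exists>\<^sub>F y in at 0. u y < v 0 + e \<and> y \<in> \<Omega> \<inter> ball 0 (\<sigma> / 4) - {0}"
          by (rule frequently_eventually_frequently)
        then obtain y where y: "u y < v 0 + e" "y \<in> \<Omega>" "y \<noteq> 0" "norm y < \<sigma> / 4"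
          using frequently_ex by fastforce
        have "norm (x + (1 + \<epsilon>') *\<^sub>R y) \<le> norm x + (1 + \<epsilon>') * norm y"
          using norm_triangle_ineq[of x "(1 + \<epsilon>') *\<^sub>R y"] \<epsilon>'(1) by simp
        also have "(1 + \<epsilon>') * norm y \<le> 2 * norm y" using \<epsilon>'(6) by (intro mult_right_mono) auto
        finally have "norm (x + (1 + \<epsilon>') *\<^sub>R y) < \<sigma>" using x \<delta>(5) y(4) by linarith
        then have v: "v 0 - e \<le> v (x + (1 + \<epsilon>') *\<^sub>R y)" by (rule \<sigma>v)
        have "u y < (1 + \<tau>) * (v 0 - e)" using y(1) e2 by linarith
        also have "\<dots> \<le> \<phi> (1 + \<epsilon>') * v (x + (1 + \<epsilon>') *\<^sub>R y)"
          using v e3 \<tau> \<kappa>(3)[of \<epsilon>'] \<epsilon>' by (intro mult_mono) (auto simp: \<tau>_def)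
        finally show ?thesis using y(2,3) by (intro bexI[of _ y]) (auto simp: v_phi_def)
      qed
    qed
    then obtain t where "t \<in> {1 - \<epsilon>'..1 + \<epsilon>'}" "(INF y\<in>\<Omega> - {0}. ereal (u y - v_phi \<phi> v x t y)) = 0"
      by blast
    then show "\<exists>lam. \<bar>lam - 1\<bar> < \<epsilon> \<and> (INF y\<in>\<Omega> - {0}. ereal (u y - v_phi \<phi> v x lam y)) = 0"
      using \<epsilon>'(2) by (intro exI[of _ t]) auto
  qed (rule \<delta>(1))
qed

section \<open>Functions of class \<open>C\<^sup>1\<close> and their linear minorants\<close>

lemma gradient_of_partials:
  fixes f :: "'a::euclidean_space \<Rightarrow> real"
  assumes "f differentiable (at x)"
  shows "(f has_derivative (\<lambda>h. (\<Sum>b\<in>Basis. partial b f x *\<^sub>R b) \<bullet> h)) (at x)"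
proof -
  let ?f' = "frechet_derivative f (at x)"
  have f': "(f has_derivative ?f') (at x)"
    using assms by (simp add: frechet_derivative_works)
  have "?f' h = (\<Sum>b\<in>Basis. partial b f x *\<^sub>R b) \<bullet> h" for h
  proof -
    have "?f' h = ?f' (\<Sum>b\<in>Basis. (h \<bullet> b) *\<^sub>R b)" by (simp add: euclidean_representation)
    also have "\<dots> = (\<Sum>b\<in>Basis. (h \<bullet> b) * ?f' b)"
      using has_derivative_linear[OF f'] by (simp add: linear_sum linear_scale)
    finally show ?thesis
      by (simp add: inner_sum_left partial_def inner_commute[of h] mult.commute)
  qed
  then show ?thesis using f' by presburger
qed

lemma C_1_lipschitz_near:
  fixes f :: "'a::euclidean_space \<Rightarrow> real"
  assumes "open W" "z \<in> W" "C_k_on 1 W f"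
  obtains \<rho> L where "\<rho> > 0" "ball z \<rho> \<subseteq> W" "L \<ge> 0"
    "\<And>x y. x \<in> ball z \<rho> \<Longrightarrow> y \<in> ball z \<rho> \<Longrightarrow> \<bar>f x - f y\<bar> \<le> L * norm (x - y)"
proof -
  define G where "G = (\<lambda>x. \<Sum>b\<in>Basis. partial b f x *\<^sub>R b)"
  obtain \<rho> where \<rho>: "\<rho> > 0" "cball z \<rho> \<subseteq> W"
    using assms(1,2) open_contains_cball by blast
  have "continuous_on W G"
    using assms(3) unfolding G_def by (intro continuous_intros) auto
  then have "bounded (G ` cball z \<rho>)"
    using \<rho>(2) by (intro compact_imp_bounded compact_continuous_image continuous_on_subset[OF _ \<rho>(2)]) auto
  then obtain L where L: "\<And>x. x \<in> cball z \<rho> \<Longrightarrow> norm (G x) \<le> L"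
    unfolding bounded_iff by blast
  have D: "(f has_derivative (\<lambda>h. G x \<bullet> h)) (at x within ball z \<rho>)" if "x \<in> ball z \<rho>" for x
  proof -
    have "x \<in> W" using \<rho>(2) that ball_subset_cball by blast
    then have "f differentiable (at x)" using assms(3) by simp
    then show ?thesis
      unfolding G_def by (rule has_derivative_at_withinI[OF gradient_of_partials])
  qed
  have onorm: "onorm (\<lambda>h. G x \<bullet> h) \<le> L" if "x \<in> ball z \<rho>" for x
  proof (rule onorm_le)
    fix h
    have "\<bar>G x \<bullet> h\<bar> \<le> norm (G x) * norm h" by (rule Cauchy_Schwarz_ineq2)
    also have "\<dots> \<le> L * norm h" using L[of x] that by (intro mult_right_mono) auto
    finally show "norm (G x \<bullet> h) \<le> L * norm h" by simp
  qed
  have "norm (f x - f y) \<le> L * norm (x - y)" if "x \<in> ball z \<rho>" "y \<in> ball z \<rho>" for x y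
    by (rule differentiable_bound[OF convex_ball D onorm that])
  moreover have "L \<ge> 0" using L[of z] norm_ge_zero[of "G z"] \<rho>(1) by (meson centre_in_cball less_imp_le order_trans)
  ultimately show thesis using that[of \<rho> L] \<rho> ball_subset_cball by (metis order_trans real_norm_def)
qed

lemma frequently_less_of_Liminf_le:
  assumes "Liminf F (\<lambda>x. ereal (f x)) \<le> ereal c" "c < e"
  shows "\<exists>\<^sub>F x in F. f x < e"
proof (rule ccontr)
  assume "\<not> ?thesis"
  then have "\<forall>\<^sub>F x in F. ereal e \<le> ereal (f x)" by (simp add: frequently_def not_less)
  then have "ereal e \<le> Liminf F (\<lambda>x. ereal (f x))" by (rule Liminf_bounded)
  then show False using assms by (meson ereal_less_le leD less_ereal.simps(1) order_trans)
qed

text \<open>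
  Along the ray through \<open>y\<close> let \<open>f t = v (t y)\<close> and \<open>s = G 0 \<bullet> y\<close>, so that \<open>\<phi> \<lambda> \<lambda> f' t = s\<close>. If
  \<open>s \<ge> 0\<close>, then \<open>f\<close> increases, so \<open>\<phi> \<lambda> = v 0 / f t \<le> 1\<close>, hence \<open>\<lambda> \<le> 1\<close> and \<open>f' t \<ge> s\<close>. If \<open>s < 0\<close>, then
  \<open>f\<close> decreases, \<open>\<phi> \<lambda>\<close> and \<open>\<lambda>\<close> are at least \<open>1\<close>, and dividing the negative number \<open>s\<close> by their product
  again gives \<open>f' t \<ge> s\<close>.
\<close>
lemma linear_minorant_along_rays:
  fixes v :: "'a::real_inner \<Rightarrow> real"
  assumes deriv: "\<And>x. norm x < \<delta> \<Longrightarrow> (v has_derivative (\<lambda>h. G x \<bullet> h)) (at x)"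
    and v_pos: "\<And>x. norm x < \<delta> \<Longrightarrow> v x > 0"
    and rel: "\<And>x. norm x < \<delta> \<Longrightarrow> \<exists>lam>0. \<phi> lam * v x = v 0 \<and> (\<phi> lam * lam) *\<^sub>R G x = G 0 \<and>
        (lam < 1 \<longrightarrow> \<phi> lam < 1) \<and> (1 < lam \<longrightarrow> 1 < \<phi> lam)"
    and y: "norm y < \<delta>"
  shows "v 0 + G 0 \<bullet> y \<le> v y"
proof -
  define s where "s = G 0 \<bullet> y"
  define f where "f = (\<lambda>t. v (t *\<^sub>R y))"
  define f' where "f' = (\<lambda>t. G (t *\<^sub>R y) \<bullet> y)"
  have ty: "norm (t *\<^sub>R y) < \<delta>" if "t \<in> {0..1}" for t
  proof -
    have "norm (t *\<^sub>R y) \<le> 1 * norm y" using that by (simp add: mult_left_le_one_le)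
    with y show ?thesis by simp
  qed
  have f: "(f has_real_derivative f' t) (at t)" if "t \<in> {0..1}" for t
  proof -
    have "((\<lambda>t. v (t *\<^sub>R y)) has_derivative (\<lambda>h. G (t *\<^sub>R y) \<bullet> (h *\<^sub>R y))) (at t)"
      by (rule has_derivative_compose[where f = "\<lambda>t. t *\<^sub>R y", OF _ deriv[OF ty[OF that]]])
        (auto intro!: derivative_eq_intros)
    then show ?thesis
      by (simp add: has_field_derivative_def f_def f'_def mult_commute_abs)
  qed
  have mvt: "\<exists>\<xi>\<in>{0..1}. f t - f 0 = t * f' \<xi>" if t: "t \<in> {0..1}" for t
  proof (cases "t = 0")
    case False
    then have "\<exists>\<xi>. \<xi> > 0 \<and> \<xi> < t \<and> f t - f 0 = (t - 0) * f' \<xi>"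
      using t f by (intro MVT2) auto
    then obtain \<xi> where "\<xi> > 0" "\<xi> < t" "f t - f 0 = t * f' \<xi>" by auto
    then show ?thesis using t by (intro bexI[of _ \<xi>]) auto
  qed auto
  have v0: "v 0 > 0" using v_pos[of 0] y norm_ge_zero[of y] by simp
  have param: "\<exists>lam p. lam > 0 \<and> p > 0 \<and> p * f t = v 0 \<and> p * lam * f' t = s \<and>
      (lam < 1 \<longrightarrow> p < 1) \<and> (1 < lam \<longrightarrow> 1 < p)" if t: "t \<in> {0..1}" for t
  proof -
    obtain lam where lam: "lam > 0" "\<phi> lam * v (t *\<^sub>R y) = v 0" "(\<phi> lam * lam) *\<^sub>R G (t *\<^sub>R y) = G 0"
      "lam < 1 \<longrightarrow> \<phi> lam < 1" "1 < lam \<longrightarrow> 1 < \<phi> lam"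
      using rel[OF ty[OF t]] by blast
    have "\<phi> lam > 0" using lam(2) v0 v_pos[OF ty[OF t]] by (metis zero_less_mult_pos2)
    moreover have "\<phi> lam * lam * f' t = s"
      using lam(3) by (simp add: f'_def s_def flip: inner_scaleR_left)
    ultimately show ?thesis using lam by (intro exI[of _ lam] exI[of _ "\<phi> lam"]) (auto simp: f_def)
  qed
  have slope: "s \<le> f' t" if t: "t \<in> {0..1}" for t
  proof (cases "s \<ge> 0")
    case True
    have sign: "f' \<xi> \<ge> 0" if "\<xi> \<in> {0..1}" for \<xi>
      using param[OF that] True by (metis mult_pos_pos zero_le_mult_iff not_less)
    then have "f 0 \<le> f t" using sign mvt[OF t] t by (metis atLeastAtMost_iff diff_ge_0_iff_ge mult_nonneg_nonneg)
    obtain lam p where p: "lam > 0" "p > 0" "p * f t = v 0" "p * lam * f' t = s"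
      "1 < lam \<longrightarrow> 1 < p" using param[OF t] by blast
    have "p * f t \<le> 1 * f t" using \<open>f 0 \<le> f t\<close> p(3) by (simp add: f_def)
    then have "p \<le> 1" using \<open>f 0 \<le> f t\<close> v0 by (simp add: f_def)
    with p have "p * lam \<le> 1" by (intro mult_le_one) auto
    moreover have "f' t \<ge> 0" using t by (rule sign)
    ultimately show ?thesis using p(4) mult_right_mono[of "p * lam" 1 "f' t"] by simp
  next
    case False
    have sign: "f' \<xi> \<le> 0" if "\<xi> \<in> {0..1}" for \<xi>
      using param[OF that] False by (metis mult_pos_pos mult_nonneg_nonneg less_imp_le not_le)
    then have "f t \<le> f 0" using sign mvt[OF t] t by (metis atLeastAtMost_iff diff_le_0_iff_le mult_nonneg_nonpos)
    obtain lam p where p: "lam > 0" "p > 0" "p * f t = v 0" "p * lam * f' t = s"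
      "lam < 1 \<longrightarrow> p < 1" using param[OF t] by blast
    have "f t > 0" using v_pos[OF ty[OF t]] by (simp add: f_def)
    moreover have "1 * f t \<le> p * f t" using \<open>f t \<le> f 0\<close> p(3) by (simp add: f_def)
    ultimately have "p \<ge> 1" by simp
    with p have "p * lam \<ge> 1" using mult_mono[of 1 p 1 lam] by auto
    moreover have "f' t \<le> 0" using t by (rule sign)
    ultimately show ?thesis using p(4) mult_right_mono_neg[of 1 "p * lam" "f' t"] by simp
  qed
  obtain \<xi> where "\<xi> \<in> {0..1}" "f 1 - f 0 = f' \<xi>" using mvt[of 1] by auto
  with slope[of \<xi>] show ?thesis by (simp add: f_def s_def)
qed

section \<open>Positivity of the lower limit\<close>

theorem theorem1p8:
  fixes \<Omega> N W :: "(real ^ 'n) set"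
    and I :: "real set"
    and u v :: "real ^ 'n \<Rightarrow> real"
    and \<phi> :: "real \<Rightarrow> real"
  assumes "CARD('n) \<ge> 2"
    and "open \<Omega>" and "bounded \<Omega>" and "0 \<in> \<Omega>"
    and "open I" and "1 \<in> I" and "C_k_on 1 I \<phi>"
    and "\<phi> 1 = 1" and "deriv \<phi> 1 > 0"
    and "continuous_on (closure \<Omega> - {0}) u"
    and "open N" and "closure \<Omega> \<subseteq> N" and "continuous_on N v"
    and "open W" and "0 \<in> W" and "C_k_on 1 W v"
    and "\<And>x. x \<in> closure \<Omega> \<Longrightarrow> v x > 0"
    and "\<And>x. x \<in> closure \<Omega> - {0} \<Longrightarrow> u x > v x"
    and "distr_laplacian_nonpos u (\<Omega> - {0})"
    and "\<exists>\<epsilon>\<^sub>3>0. \<forall>x lam. norm x < \<epsilon>\<^sub>3 \<and> \<bar>lam - 1\<bar> < \<epsilon>\<^sub>3 \<longrightarrow>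
           (INF y\<in>\<Omega> - {0}. ereal (u y - v_phi \<phi> v x lam y)) = 0 \<longrightarrow>
           Liminf (at 0) (\<lambda>y. ereal (u y - v_phi \<phi> v x lam y)) = 0"
  shows "Liminf (at 0) (\<lambda>x. ereal (u x - v x)) > 0"
proof (rule ccontr)
  assume "\<not> Liminf (at 0) (\<lambda>x. ereal (u x - v x)) > 0"
  then have lim: "Liminf (at 0) (\<lambda>x. ereal (u x - v x)) \<le> ereal 0"
    by (simp add: not_less flip: zero_ereal_def)
  note \<Omega> = assms(2-4) and I = assms(5,6) and N = assms(11-13) and W = assms(14-16)
    and v_pos = assms(17) and uv = assms(18) and super = assms(19)
  have \<Omega>C: "\<Omega> \<subseteq> closure \<Omega>" by (rule closure_subset)
  have \<Omega>_pos: "v y > 0" if "y \<in> \<Omega>" for y using v_pos \<Omega>C that by blast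
  have \<Omega>_uv: "u y > v y" if "y \<in> \<Omega>" "y \<noteq> 0" for y using uv \<Omega>C that by blast
  have \<phi>d: "\<phi> differentiable (at s)" if "s \<in> I" for s
    using assms(7) that by simp
  have \<phi>c: "continuous_on I \<phi>"
    using \<phi>d by (intro continuous_at_imp_continuous_on ballI differentiable_imp_continuous_within)
  have \<phi>': "(\<phi> has_real_derivative deriv \<phi> 1) (at 1)"
    using \<phi>d[OF I(2)] by (simp add: DERIV_deriv_iff_real_differentiable)
  obtain \<kappa> where \<kappa>: "\<kappa> > 0"
    "\<And>s. 0 < s \<Longrightarrow> s < \<kappa> \<Longrightarrow> \<phi> (1 - s) \<le> 1 - deriv \<phi> 1 / 2 * s"
    "\<And>s. 0 < s \<Longrightarrow> s < \<kappa> \<Longrightarrow> 1 + deriv \<phi> 1 / 2 * s \<le> \<phi> (1 + s)"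
    using deriv_pos_linear_bounds[OF \<phi>' assms(9,8)] by blast
  obtain \<rho> L where \<rho>: "\<rho> > 0" "ball 0 \<rho> \<subseteq> W" "L \<ge> 0"
    and lip: "\<And>x y. x \<in> ball 0 \<rho> \<Longrightarrow> y \<in> ball 0 \<rho> \<Longrightarrow> \<bar>v x - v y\<bar> \<le> L * norm (x - y)"
    using C_1_lipschitz_near[OF W] by blast
  define G where "G = (\<lambda>x. \<Sum>b\<in>Basis. partial b v x *\<^sub>R b)"
  have G: "(v has_derivative (\<lambda>h. G x \<bullet> h)) (at x)" if "norm x < \<rho>" for x
  proof -
    have "x \<in> W" using \<rho>(2) that by auto
    then show ?thesis unfolding G_def using W(3) by (intro gradient_of_partials) simp
  qed
  have v_tendsto: "(v \<longlongrightarrow> v 0) (at 0)"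
    using has_derivative_continuous[OF G[of 0]] \<rho>(1) by (simp add: continuous_at)
  have near: "\<exists>\<^sub>F y in at 0. u y < v 0 + e" if "e > 0" for e
  proof -
    have "\<exists>\<^sub>F y in at 0. u y - v y < e / 2"
      using lim that by (intro frequently_less_of_Liminf_le) auto
    moreover have "\<forall>\<^sub>F y in at 0. v y < v 0 + e / 2"
      using that by (intro order_tendstoD(2)[OF v_tendsto]) simp
    ultimately have "\<exists>\<^sub>F y in at 0. u y - v y < e / 2 \<and> v y < v 0 + e / 2"
      by (rule frequently_eventually_frequently)
    then show ?thesis by (rule frequently_elim1) linarith
  qed
  interpret punctured_superharmonic \<Omega> u 0
  proof
    show "DIM(real ^ 'n) \<ge> 2" using assms(1) by simp
    show "continuous_on (\<Omega> - {0}) u" by (rule continuous_on_subset[OF assms(10)]) (use \<Omega>C in auto)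
    show "0 \<le> u y" if "y \<in> \<Omega> - {0}" for y
      using that \<Omega>_uv[of y] \<Omega>_pos[of y] by auto
  qed (use \<Omega> super in auto)
  have punctured: "\<forall>\<^sub>F y in at 0. y \<in> \<Omega> - {0}"
    using \<Omega>(1,3) by (rule eventually_at_in_open)
  obtain \<epsilon>3 where \<epsilon>3: "\<epsilon>3 > 0" "\<And>x lam. norm x < \<epsilon>3 \<Longrightarrow> \<bar>lam - 1\<bar> < \<epsilon>3 \<Longrightarrow>
      (INF y\<in>\<Omega> - {0}. ereal (u y - v_phi \<phi> v x lam y)) = 0 \<Longrightarrow>
      Liminf (at 0) (\<lambda>y. ereal (u y - v_phi \<phi> v x lam y)) = 0"
    using assms(20) by blast
  define \<epsilon> where "\<epsilon> = min \<epsilon>3 (min \<kappa> 1)"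
  have \<epsilon>: "\<epsilon> > 0" "\<epsilon> \<le> \<epsilon>3" "\<epsilon> \<le> \<kappa>" "\<epsilon> \<le> 1" using \<epsilon>3(1) \<kappa>(1) by (auto simp: \<epsilon>_def)
  have "\<bar>v x - v y\<bar> \<le> L * norm (x - y)" if "norm x < \<rho>" "norm y < \<rho>" for x y
    using that by (intro lip) auto
  from exists_touching_parameter[OF \<Omega> I \<phi>c assms(8) \<phi>' assms(9) N \<rho>(1,3) this assms(10) v_pos uv near \<epsilon>(1)]
  obtain \<delta>1 where \<delta>1: "\<delta>1 > 0" "\<And>x. norm x < \<delta>1 \<Longrightarrow>
    \<exists>lam. \<bar>lam - 1\<bar> < \<epsilon> \<and> (INF y\<in>\<Omega> - {0}. ereal (u y - v_phi \<phi> v x lam y)) = 0"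
    by blast
  obtain r1 where r1: "r1 > 0" "cball 0 r1 \<subseteq> \<Omega>"
    using \<Omega>(1,3) open_contains_cball by blast
  define \<delta> where "\<delta> = min (min \<delta>1 \<epsilon>3) (min \<rho> r1)"
  have \<delta>: "\<delta> > 0" "\<delta> \<le> \<delta>1" "\<delta> \<le> \<epsilon>3" "\<delta> \<le> \<rho>" "\<delta> \<le> r1"
    using \<delta>1(1) \<epsilon>3(1) \<rho>(1) r1(1) by (auto simp: \<delta>_def)
  have rel: "\<exists>lam>0. \<phi> lam * v x = v 0 \<and> (\<phi> lam * lam) *\<^sub>R G x = G 0 \<and>
      (lam < 1 \<longrightarrow> \<phi> lam < 1) \<and> (1 < lam \<longrightarrow> 1 < \<phi> lam)" if x: "norm x < \<delta>" for x
  proof -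
    obtain lam where lam: "\<bar>lam - 1\<bar> < \<epsilon>" "(INF y\<in>\<Omega> - {0}. ereal (u y - v_phi \<phi> v x lam y)) = 0"
      using \<delta>1(2)[of x] x \<delta>(2) by auto
    define w where "w = v_phi \<phi> v x lam"
    have w0: "w 0 = \<phi> lam * v x" by (simp add: w_def v_phi_def)
    have liminf: "Liminf (at 0) (\<lambda>y. ereal (u y - w y)) = 0"
      unfolding w_def using \<epsilon>3(2)[of x lam] x \<delta>(3) lam \<epsilon>(2) by auto
    have below: "w y \<le> u y" if "y \<in> \<Omega> - {0}" for y
      using INF_lower[OF that, of "\<lambda>y. ereal (u y - w y)"] lam(2) by (simp add: w_def)
    have dw: "(w has_derivative (\<lambda>h. ((\<phi> lam * lam) *\<^sub>R G x) \<bullet> h)) (at 0)"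
    proof -
      have "(v has_derivative (\<lambda>h. G x \<bullet> h)) (at (x + lam *\<^sub>R 0))"
        using G[of x] x \<delta>(4) by simp
      then have "((\<lambda>y. v (x + lam *\<^sub>R y)) has_derivative (\<lambda>h. G x \<bullet> (lam *\<^sub>R h))) (at 0)"
        by (rule has_derivative_compose[where f = "\<lambda>y. x + lam *\<^sub>R y", rotated])
          (auto intro!: derivative_eq_intros)
      then have "((\<lambda>y. \<phi> lam * v (x + lam *\<^sub>R y)) has_derivative (\<lambda>h. \<phi> lam * (G x \<bullet> (lam *\<^sub>R h)))) (at 0)"
        by (rule has_derivative_mult_right)
      then show ?thesis unfolding w_def v_phi_def by (simp add: mult.assoc)
    qed
    have w_tendsto: "(w \<longlongrightarrow> w 0) (at 0)"
      using has_derivative_continuous[OF dw] by (simp add: continuous_at)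
    \<comment> \<open>\<open>w \<le> u\<close>, and \<open>u\<close> comes arbitrarily close to \<open>v 0\<close>.\<close>
    have "w 0 \<le> v 0"
    proof (rule field_le_epsilon)
      fix e :: real assume "e > 0"
      then have "\<exists>\<^sub>F y in at 0. u y < v 0 + e / 2" by (intro near) simp
      moreover have "\<forall>\<^sub>F y in at 0. w 0 - e / 2 < w y \<and> y \<in> \<Omega> - {0}"
        using \<open>e > 0\<close> by (intro eventually_conj punctured order_tendstoD(1)[OF w_tendsto]) simp
      ultimately have "\<exists>\<^sub>F y in at 0. u y < v 0 + e / 2 \<and> (w 0 - e / 2 < w y \<and> y \<in> \<Omega> - {0})"
        by (rule frequently_eventually_frequently)
      then obtain y where "u y < v 0 + e / 2" "w 0 - e / 2 < w y" "y \<in> \<Omega> - {0}"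
        using frequently_ex by blast
      with below[of y] show "w 0 \<le> v 0 + e" by linarith
    qed
    \<comment> \<open>\<open>u - w\<close> comes arbitrarily close to \<open>0\<close>, and \<open>u > v\<close>.\<close>
    moreover have "v 0 \<le> w 0"
    proof (rule field_le_epsilon)
      fix e :: real assume "e > 0"
      then have "\<exists>\<^sub>F y in at 0. u y - w y < e / 3"
        using liminf by (intro frequently_less_of_Liminf_le[where c = 0]) (auto simp: zero_ereal_def)
      moreover have "\<forall>\<^sub>F y in at 0. (w y < w 0 + e / 3 \<and> v 0 - e / 3 < v y) \<and> y \<in> \<Omega> - {0}"
        using \<open>e > 0\<close> by (intro eventually_conj punctured order_tendstoD(2)[OF w_tendsto] order_tendstoD(1)[OF v_tendsto]) auto
      ultimately have "\<exists>\<^sub>F y in at 0. u y - w y < e / 3 \<and> ((w y < w 0 + e / 3 \<and> v 0 - e / 3 < v y) \<and> y \<in> \<Omega> - {0})"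
        by (rule frequently_eventually_frequently)
      then obtain y where "u y - w y < e / 3" "w y < w 0 + e / 3" "v 0 - e / 3 < v y" "y \<in> \<Omega> - {0}"
        using frequently_ex by blast
      with \<Omega>_uv[of y] show "v 0 \<le> w 0 + e" by auto
    qed
    ultimately have w0_eq: "w 0 = v 0" by simp
    have "(\<phi> lam * lam) *\<^sub>R G x = G 0"
    proof (rule touching_gradients_eq[OF dw w0_eq G[of 0] refl])
      show "\<forall>\<^sub>F y in at 0. w y \<le> u y \<and> v y \<le> u y"
        using punctured by eventually_elim (use below \<Omega>_uv in \<open>auto intro: less_imp_le\<close>)
    qed (use \<rho>(1) near in auto)
    moreover have "\<phi> lam < 1" if "lam < 1"
    proof -
      have "\<phi> lam \<le> 1 - deriv \<phi> 1 / 2 * (1 - lam)"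
        using \<kappa>(2)[of "1 - lam"] lam(1) \<epsilon>(3) that by simp
      then show ?thesis using mult_pos_pos[of "deriv \<phi> 1 / 2" "1 - lam"] assms(9) that by linarith
    qed
    moreover have "1 < \<phi> lam" if "1 < lam"
    proof -
      have "1 + deriv \<phi> 1 / 2 * (lam - 1) \<le> \<phi> lam"
        using \<kappa>(3)[of "lam - 1"] lam(1) \<epsilon>(3) that by simp
      then show ?thesis using mult_pos_pos[of "deriv \<phi> 1 / 2" "lam - 1"] assms(9) that by linarith
    qed
    moreover have "lam > 0" using lam(1) \<epsilon>(4) by linarith
    ultimately show ?thesis using w0_eq w0 by auto
  qed
  have minorant: "v 0 + G 0 \<bullet> y \<le> v y" if "norm y < \<delta>" for y
  proof (rule linear_minorant_along_rays[where v = v and G = G and \<phi> = \<phi> and \<delta> = \<delta>, OF _ _ rel that])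
    show "(v has_derivative (\<lambda>h. G x \<bullet> h)) (at x)" if "norm x < \<delta>" for x
      using that \<delta>(4) by (intro G) simp
    show "v x > 0" if "norm x < \<delta>" for x
      using that \<delta>(5) r1(2) by (intro \<Omega>_pos) auto
  qed
  define r where "r = \<delta> / 2"
  have r: "r > 0" "r < \<delta>" "cball 0 r \<subseteq> \<Omega>"
    using \<delta>(1,5) r1(2) by (auto simp: r_def)
  obtain m where m: "m > 0" "\<And>y. y \<in> sphere 0 r \<Longrightarrow> m \<le> u y - v y"
  proof (rule compact_positive_lower_bound[of "sphere 0 r" "\<lambda>y. u y - v y"])
    have S: "sphere 0 r \<subseteq> closure \<Omega> - {0}" using r \<Omega>C by auto
    then show "continuous_on (sphere 0 r) (\<lambda>y. u y - v y)"
      using N(2) by (intro continuous_intros continuous_on_subset[OF assms(10)] continuous_on_subset[OF N(3)]) auto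
    show "0 < u y - v y" if "y \<in> sphere 0 r" for y
      using uv[OF subsetD[OF S that]] by simp
  qed auto
  \<comment> \<open>On the sphere \<open>u \<ge> v + m\<close>, and \<open>v\<close> lies above its linearisation at the origin.\<close>
  have "(v 0 + m) + G 0 \<bullet> 0 \<le> v 0"
  proof (rule harmonic_minorant_at_0[OF r(1,3), where D = "\<lambda>b y. 0" and h = "\<lambda>y. (v 0 + m) + G 0 \<bullet> y"])
    show "continuous_on (cball 0 r) (\<lambda>y. (v 0 + m) + G 0 \<bullet> y)" by (intro continuous_intros)
    show "(second_diff (\<lambda>y. (v 0 + m) + G 0 \<bullet> y) b x \<longlongrightarrow> 0) (at_right 0)" for b x
      unfolding second_diff_add second_diff_const second_diff_inner by simp
    show "(v 0 + m) + G 0 \<bullet> y \<le> u y" if "norm y = r" for y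
      using m(2)[of y] minorant[of y] r(2) that by auto
  qed (use near in auto)
  with m(1) show False by simp
qed

end
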